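(* Every infinite, discrete abelian group $\Gamma$ contains a Sidon set that is not an $I_0$ set.
   Context: $\Gamma$ is a discrete abelian group and $G$ is its compact dual group; elements of $\Gamma$ are regarded as continuous characters on $G$. For a (finite, complex, regular Borel) measure $\mu$ on $G$, $\widehat{\mu}(\gamma) = \int_G \overline{\gamma}\, d\mu$. A subset $E \subseteq \Gamma$ is a Sidon set if for every bounded function $\phi : E \to \mathbb{C}$ there is a measure $\mu$ on $G$ with $\widehat{\mu}(\gamma) = \phi(\gamma)$ for all $\gamma \in E$. It is an $I_0$ set if the interpolating measure $\mu$ can always be chosen to be discrete (i.e. $\mu = \sum_k a_k \delta_{x_k}$ with $x_k\in G$ and $\sum_k |a_k| < \infty$). *)

theory Defs
  imports "HOL-Analysis.Analysis"
begin

definition complex_measure :: "'b measure \<Rightarrow> ('b set \<Rightarrow> complex) \<Rightarrow> bool" where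
  "complex_measure M \<mu> \<longleftrightarrow>
     (\<forall>A :: nat \<Rightarrow> 'b set. range A \<subseteq> sets M \<longrightarrow> disjoint_family A \<longrightarrow>
        (\<lambda>n. \<mu> (A n)) sums \<mu> (\<Union>n. A n))"

definition total_variation :: "'b measure \<Rightarrow> ('b set \<Rightarrow> complex) \<Rightarrow> 'b set \<Rightarrow> ennreal" where
  "total_variation M \<mu> A =
     (SUP P \<in> {P. finite P \<and> P \<subseteq> sets M \<and> disjoint P \<and> \<Union>P = A}.
        \<Sum>B\<in>P. ennreal (cmod (\<mu> B)))"

(* The upper (positive) variation of a real signed measure \<nu>. Since ennreal maps negative
   reals to 0, and B = {} is allowed, this is the positive part in the Jordan decomposition
   of \<nu>; the negative part is the positive variation of -\<nu>. *)
definition positive_variation :: "'b measure \<Rightarrow> ('b set \<Rightarrow> real) \<Rightarrow> 'b measure" where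
  "positive_variation M \<nu> =
     measure_of (space M) (sets M) (\<lambda>A. SUP B \<in> {B \<in> sets M. B \<subseteq> A}. ennreal (\<nu> B))"

definition signed_integral :: "'b measure \<Rightarrow> ('b set \<Rightarrow> real) \<Rightarrow> ('b \<Rightarrow> complex) \<Rightarrow> complex" where
  "signed_integral M \<nu> f =
     (LINT x|positive_variation M \<nu>. f x) - (LINT x|positive_variation M (\<lambda>A. - \<nu> A). f x)"

definition complex_measure_integral ::
    "'b measure \<Rightarrow> ('b set \<Rightarrow> complex) \<Rightarrow> ('b \<Rightarrow> complex) \<Rightarrow> complex" where
  "complex_measure_integral M \<mu> f =
     signed_integral M (\<lambda>A. Re (\<mu> A)) f + \<i> * signed_integral M (\<lambda>A. Im (\<mu> A)) f"

(* The discrete group is the type 'a itself. Its dual is a set of functions 'a => complex,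
   carrying the subspace topology of the product topology on the function type: for a
   discrete group the compact-open topology on the dual is that of pointwise convergence. *)
definition dual_group :: "('a::ab_group_add \<Rightarrow> complex) set" where
  "dual_group = {x. (\<forall>\<gamma>. cmod (x \<gamma>) = 1) \<and> (\<forall>\<gamma> \<delta>. x (\<gamma> + \<delta>) = x \<gamma> * x \<delta>)}"

(* Only the underlying Borel sigma-algebra is relevant; the measure carried by this
   space is never used. *)
definition dual_borel :: "('a::ab_group_add \<Rightarrow> complex) measure" where
  "dual_borel = restrict_space borel dual_group"

definition regular_dual_measure :: "(('a::ab_group_add \<Rightarrow> complex) set \<Rightarrow> complex) \<Rightarrow> bool" where
  "regular_dual_measure \<mu> \<longleftrightarrow>
     complex_measure dual_borel \<mu> \<and>
     (\<forall>A \<in> sets dual_borel. \<forall>\<epsilon>>0. \<exists>K U.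
        compact K \<and> openin (top_of_set dual_group) U \<and> K \<subseteq> A \<and> A \<subseteq> U \<and>
        total_variation dual_borel \<mu> (U - K) < \<epsilon>)"

definition discrete_dual_measure :: "(('a::ab_group_add \<Rightarrow> complex) set \<Rightarrow> complex) \<Rightarrow> bool" where
  "discrete_dual_measure \<mu> \<longleftrightarrow>
     (\<exists>(a :: nat \<Rightarrow> complex) (x :: nat \<Rightarrow> 'a \<Rightarrow> complex).
        range x \<subseteq> dual_group \<and> summable (\<lambda>k. cmod (a k)) \<and>
        (\<forall>A \<in> sets dual_borel. \<mu> A = (\<Sum>k. a k * indicator A (x k))))"

(* The element \<gamma> of the group acts on its dual as the character \<lambda>x. x \<gamma>. *)
definition fourier_transform ::
    "(('a::ab_group_add \<Rightarrow> complex) set \<Rightarrow> complex) \<Rightarrow> 'a \<Rightarrow> complex" where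
  "fourier_transform \<mu> \<gamma> = complex_measure_integral dual_borel \<mu> (\<lambda>x. cnj (x \<gamma>))"

definition Sidon_set :: "'a::ab_group_add set \<Rightarrow> bool" where
  "Sidon_set E \<longleftrightarrow>
     (\<forall>\<phi> :: 'a \<Rightarrow> complex. bounded (\<phi> ` E) \<longrightarrow>
        (\<exists>\<mu>. regular_dual_measure \<mu> \<and> (\<forall>\<gamma>\<in>E. fourier_transform \<mu> \<gamma> = \<phi> \<gamma>)))"

definition I0_set :: "'a::ab_group_add set \<Rightarrow> bool" where
  "I0_set E \<longleftrightarrow>
     (\<forall>\<phi> :: 'a \<Rightarrow> complex. bounded (\<phi> ` E) \<longrightarrow>
        (\<exists>\<mu>. regular_dual_measure \<mu> \<and> discrete_dual_measure \<mu> \<and>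
             (\<forall>\<gamma>\<in>E. fourier_transform \<mu> \<gamma> = \<phi> \<gamma>)))"

end

theory Submission
  imports "HOL-Probability.Helly_Selection" Defs
begin

text \<open>Choose a very sparse sequence and split it into sequences \<open>c\<close> and \<open>d\<close> such that every
  difference \<open>c i - c j\<close> with \<open>i < j\<close> occurs as some \<open>r k\<close>, where \<open>r k\<close> involves only terms far
  below \<open>d k\<close>. The set consists of all \<open>d k\<close> and all \<open>d k + r k\<close>.

  It is not \<open>I\<^sub>0\<close>: finitely many characters carry almost all of the mass of a discrete measure, and by
  compactness they are all close to \<open>1\<close> at some \<open>c i - c j = r k\<close>. So its transform cannot be \<open>1\<close> at
  every \<open>d k\<close> and \<open>0\<close> at every \<open>d k + r k\<close>.

  It is Sidon: both sequences are dissociate, and neither meets the Fourier support of the Riesz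
  products over the other, so averages of two Riesz products interpolate small real functions.
  Haar measure is avoided. A finite Riesz product is integrated against a uniform distribution on
  finitely many characters that annihilates all relevant nonzero group elements. The values of a
  character on the set are coded as one real number, and Helly's theorem gives a weak limit on the line.
  This limit is carried to the dual group by a continuous map, which exists because real function
  spaces are divisible; as the image of a measure on the line, the result is regular.\<close>

subsection \<open>Subgroups and divisibility\<close>

text \<open>In terms of the Bohr compactification, the closures of the \<open>d k\<close> and of the
  \<open>d k + r k\<close> meet because the \<open>r k\<close> accumulate at 0; that is why all
  differences of the \<open>c i\<close> have to occur. The same requirement is the obstacle on the
  Sidon side: telescoping \<open>(c i - c j) + (c j - c l) = c i - c l\<close> gives relations
  between six members of the set, so the whole set is not dissociate and a single Riesz product over
  it fails. Hence two products, each blind to the other half. Averaging them costs a factor 2, and a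
  Riesz product with coefficients bounded by 1 reaches only 1/2 at a generator that is not of order
  two; this is the origin of the bound 1/4. The prescribed values are real because a positive
  measure has a real coefficient at every element of order two; real and imaginary parts of a
  complex function are interpolated separately. Up to that last combination all measures are
  probabilities, a class stable under weak limits of tight sequences and under images.\<close>

definition zmul :: "int \<Rightarrow> 'a::ab_group_add \<Rightarrow> 'a" where
  "zmul k x = (if 0 \<le> k then (\<Sum>i<nat k. x) else - (\<Sum>i<nat (- k). x))"

lemma zmul_0 [simp]: "zmul 0 x = 0"
  by (simp add: zmul_def)

lemma zmul_succ: "zmul (k + 1) x = zmul k x + x"
\<comment> \<open>Multiples are constant sums, so a step by one only changes the number of summands,
  on either side of 0.\<close>
proof (cases "0 \<le> k")
  case True
  then have "nat (k + 1) = Suc (nat k)" by simp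
  with True show ?thesis by (simp add: zmul_def)
next
  case False
  then have "nat (- k) = Suc (nat (- (k + 1)))" by simp
  with False show ?thesis by (auto simp: zmul_def algebra_simps)
qed

lemma zmul_1 [simp]: "zmul 1 x = x"
  using zmul_succ [of 0 x] by simp

lemma zmul_add: "zmul (k + l) x = zmul k x + zmul l x"
proof (induction l rule: int_induct [where k = 0])
  case (step1 i)
  then show ?case using zmul_succ [of "k + i" x] zmul_succ [of i x] by (simp add: algebra_simps)
next
  case (step2 i)
  then show ?case using zmul_succ [of "k + i - 1" x] zmul_succ [of "i - 1" x]
    by (simp add: algebra_simps)
qed simp

lemma zmul_minus: "zmul (- k) x = - zmul k x"
  using zmul_add [of k "- k" x] by (simp add: eq_neg_iff_add_eq_0 add.commute)

lemma zmul_diff: "zmul (k - l) x = zmul k x - zmul l x"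
  using zmul_add [of k "- l" x] by (simp add: zmul_minus)

lemma zmul_mult: "zmul (k * l) x = zmul k (zmul l x)"
proof (induction k rule: int_induct [where k = 0])
  case (step1 i)
  then show ?case by (simp add: ring_distribs zmul_add zmul_succ)
next
  case (step2 i)
  then show ?case by (simp add: left_diff_distrib zmul_diff)
qed simp

lemma fst_zmul [simp]: "fst (zmul k z) = zmul k (fst z)"
  by (simp add: zmul_def fst_sum)

lemma snd_zmul: "snd (zmul k z) = of_int k *\<^sub>R (snd z :: 'v::real_vector)"
  by (auto simp: zmul_def snd_sum scaleR_conv_of_real sum_constant_scaleR)

definition add_subgroup :: "'a::ab_group_add set \<Rightarrow> bool" where
  "add_subgroup P \<longleftrightarrow> 0 \<in> P \<and> (\<forall>x\<in>P. \<forall>y\<in>P. x - y \<in> P)"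

lemma add_subgroup_zero: "add_subgroup P \<Longrightarrow> 0 \<in> P"
  and add_subgroup_diff: "add_subgroup P \<Longrightarrow> x \<in> P \<Longrightarrow> y \<in> P \<Longrightarrow> x - y \<in> P"
  by (auto simp: add_subgroup_def)

lemma add_subgroup_add: "add_subgroup P \<Longrightarrow> x \<in> P \<Longrightarrow> y \<in> P \<Longrightarrow> x + y \<in> P"
  using add_subgroup_diff [of P x "0 - y"] add_subgroup_diff [of P 0 y]
  by (simp add: add_subgroup_zero)

lemma add_subgroup_zmul:
  assumes "add_subgroup P" "x \<in> P"
  shows "zmul k x \<in> P"
proof (induction k rule: int_induct [where k = 0])
  case (step2 i)
  then show ?case using assms by (simp add: zmul_diff add_subgroup_diff)
qed (use assms in \<open>simp_all add: zmul_succ add_subgroup_zero add_subgroup_add\<close>)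

text \<open>Division with remainder by the least positive element. The trivial subgroup has
  generator 0, and \<open>0 dvd k\<close> means \<open>k = 0\<close>; in the applications this is
  the case of infinite order, or of a cyclic group that meets a given domain trivially.\<close>

lemma add_subgroup_int_generator:
  fixes N :: "int set"
  assumes N: "add_subgroup N"
  obtains n where "n \<in> N" "\<And>k. k \<in> N \<Longrightarrow> n dvd k"
proof (cases "N \<subseteq> {0}")
  case True
  then show thesis using that [of 0] add_subgroup_zero [OF N] by auto
next
  case False
  have zmul_int: "zmul k x = k * x" for k x :: int
    by (simp add: zmul_def)
  from False obtain k where k: "k \<in> N" "k \<noteq> 0" by auto
  have "\<bar>k\<bar> \<in> N"
    using add_subgroup_diff [OF N add_subgroup_zero [OF N] k(1)] k by (auto simp: abs_if)
  then have ex: "\<exists>m. 0 < m \<and> int m \<in> N"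
    using k by (intro exI [of _ "nat \<bar>k\<bar>"]) auto
  define m where "m = (LEAST m. 0 < m \<and> int m \<in> N)"
  have m: "0 < m" "int m \<in> N"
    using LeastI_ex [OF ex] by (auto simp: m_def)
  have "int m dvd l" if l: "l \<in> N" for l
  proof (rule ccontr)
    assume nd: "\<not> int m dvd l"
    have "l mod int m = l - zmul (l div int m) (int m)"
      by (simp add: zmul_int minus_div_mult_eq_mod)
    then have "l mod int m \<in> N"
      using add_subgroup_diff [OF N l add_subgroup_zmul [OF N m(2)]] by metis
    moreover have "l mod int m > 0" "l mod int m < int m"
      using nd m(1) pos_mod_sign [of "int m" l] by (auto simp: dvd_eq_mod_eq_0 order_le_less)
    ultimately have "0 < nat (l mod int m) \<and> int (nat (l mod int m)) \<in> N" "nat (l mod int m) < m"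
      by auto
    then show False using not_less_Least unfolding m_def by blast
  qed
  then show thesis using that m(2) by blast
qed

text \<open>A real vector space is divisible, so homomorphisms into a quotient of it extend. Homomorphisms
  are represented by their graphs, which are subgroups of the product.\<close>

lemma divisible_extension:
  fixes P0 :: "('a::ab_group_add \<times> 'v::real_vector) set"
  assumes P0: "add_subgroup P0"
  obtains P where "add_subgroup P" "P0 \<subseteq> P" "fst ` P = UNIV"
    "\<And>v. (0, v) \<in> P \<Longrightarrow> (0, v) \<in> P0"
proof -
  define \<A> where "\<A> = {P. add_subgroup P \<and> P0 \<subseteq> P \<and> (\<forall>v. (0, v) \<in> P \<longrightarrow> (0, v) \<in> P0)}"
  have "\<exists>U\<in>\<A>. \<forall>X\<in>C. X \<subseteq> U" if C: "C \<in> chains \<A>" for C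
  proof (cases "C = {}")
    case True
    then show ?thesis using P0 by (auto simp: \<A>_def intro!: bexI [of _ P0])
  next
    case False
    have sub: "X \<in> C \<Longrightarrow> X \<in> \<A>" for X using C by (auto simp: chains_def)
    have "x - y \<in> \<Union>C" if x: "x \<in> \<Union>C" and y: "y \<in> \<Union>C" for x y
    proof -
      obtain X Y where XY: "X \<in> C" "Y \<in> C" "x \<in> X" "y \<in> Y" using x y by blast
      then obtain Z where "Z \<in> C" "x \<in> Z" "y \<in> Z" using chainsD [OF C, of X Y] by blast
      then show ?thesis using sub [of Z] by (auto simp: \<A>_def add_subgroup_def)
    qed
    moreover have "0 \<in> \<Union>C" "P0 \<subseteq> \<Union>C" using False sub by (auto simp: \<A>_def add_subgroup_def)
    ultimately have "\<Union>C \<in> \<A>"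
      using sub unfolding \<A>_def by (auto simp: add_subgroup_def)
    then show ?thesis by blast
  qed
  then obtain P where P: "P \<in> \<A>" and max: "\<And>X. X \<in> \<A> \<Longrightarrow> P \<subseteq> X \<Longrightarrow> X = P"
    using Zorn_Lemma2 [of \<A>] by meson
  have sg: "add_subgroup P" using P by (simp add: \<A>_def)
  have "g \<in> fst ` P" for g
  proof -
    \<comment> \<open>The multiples of \<open>g\<close> already in the domain of the partial
      homomorphism form a cyclic group. Its generator \<open>zmul n g\<close> carries the only
      constraint on a value at \<open>g\<close>.\<close>
    have "add_subgroup {k. zmul k g \<in> fst ` P}"
    proof -
      have "zmul (k - l) g \<in> fst ` P" if "zmul k g \<in> fst ` P" "zmul l g \<in> fst ` P" for k l
      proof -
        from that(1) obtain x where x: "zmul k g = fst x" "x \<in> P" by (rule imageE)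
        from that(2) obtain y where y: "zmul l g = fst y" "y \<in> P" by (rule imageE)
        show ?thesis
          using add_subgroup_diff [OF sg x(2) y(2)] x(1) y(1)
          by (intro image_eqI [of _ fst "x - y"]) (simp_all add: zmul_diff)
      qed
      then show ?thesis
        using add_subgroup_zero [OF sg] by (auto simp: add_subgroup_def intro!: image_eqI [of 0 fst 0])
    qed
    then obtain n where n: "zmul n g \<in> fst ` P" and dvd: "\<And>k. zmul k g \<in> fst ` P \<Longrightarrow> n dvd k"
      using add_subgroup_int_generator by (metis mem_Collect_eq)
    then obtain v where v: "(zmul n g, v) \<in> P" by auto
    \<comment> \<open>Divisibility enters here: the value at \<open>g\<close> is
      \<open>v / n\<close>. For \<open>n = 0\<close> there is no constraint, and any
      \<open>w\<close> will do.\<close>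
    obtain w where w: "zmul n (g, w) \<in> P"
    proof (cases "n = 0")
      case True
      then show thesis using add_subgroup_zero [OF sg] that by simp
    next
      case False
      have "zmul n (g, (1 / of_int n) *\<^sub>R v) = (zmul n g, v)"
        using False by (intro prod_eqI) (simp_all add: snd_zmul)
      then show thesis using that v by metis
    qed
    define z where "z = (g, w)"
    define Q where "Q = {p + zmul k z | p k. p \<in> P}"
    have "p + zmul k z - (q + zmul l z) = (p - q) + zmul (k - l) z" for p q k l
      by (simp add: zmul_diff algebra_simps)
    then have "x - y \<in> Q" if "x \<in> Q" "y \<in> Q" for x y
      using that add_subgroup_diff [OF sg] unfolding Q_def by blast
    moreover have PQ: "P \<subseteq> Q" unfolding Q_def by (metis (mono_tags, lifting) add.right_neutral mem_Collect_eq subsetI zmul_0)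
    ultimately have "add_subgroup Q" using add_subgroup_zero [OF sg] by (auto simp: add_subgroup_def)
    \<comment> \<open>Adjoining \<open>z\<close> creates no new vertical elements: if
      \<open>p + zmul k z\<close> is vertical, then \<open>zmul k g\<close> lies in the old domain,
      so \<open>n\<close> divides \<open>k\<close> and \<open>zmul k z\<close> is a multiple of
      \<open>zmul n z\<close>, which is in \<open>P\<close>.\<close>
    moreover have "(0, u) \<in> P0" if "(0, u) \<in> Q" for u
    proof -
      obtain p k where p: "p \<in> P" "(0, u) = p + zmul k z" using \<open>(0, u) \<in> Q\<close> by (auto simp: Q_def)
      then have "0 = fst p + zmul k g" by (metis fst_add fst_conv fst_zmul z_def)
      then have "zmul k g = fst (0 - p)" by (simp add: eq_neg_iff_add_eq_0 add.commute)
      moreover have "0 - p \<in> P" using add_subgroup_diff [OF sg add_subgroup_zero [OF sg] p(1)] .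
      ultimately have "zmul k g \<in> fst ` P" by blast
      then obtain l where "k = l * n" using dvd by (metis dvd_def mult.commute)
      then have "zmul k z \<in> P" using w add_subgroup_zmul [OF sg] by (simp add: z_def zmul_mult)
      then have "(0, u) \<in> P" using p add_subgroup_add [OF sg] by simp
      then show ?thesis using P by (simp add: \<A>_def)
    qed
    ultimately have "Q \<in> \<A>" using P PQ by (auto simp: \<A>_def)
    then have "Q = P" using max PQ by blast
    moreover have "z = 0 + zmul 1 z" by simp
    then have "z \<in> Q" using add_subgroup_zero [OF sg] unfolding Q_def by blast
    ultimately show ?thesis by (auto simp: z_def intro: image_eqI [of _ fst "(g, w)"])
  qed
  then show thesis using that [of P] P by (auto simp: \<A>_def)
qed

subsection \<open>Dissociate sequences\<close>

text \<open>The sets \<open>T n\<close> are levels: an addition raises the level by one, and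
  \<open>g n\<close> is new at level \<open>n\<close>. The final alternative controls doubling. If
  there are infinitely many elements with \<open>x + x = 0\<close>, everything is chosen among them;
  otherwise doubling has finite fibres, and \<open>g n\<close> can be chosen so that its double is
  new as well.\<close>

lemma sparse_sequence:
  assumes "infinite (UNIV :: 'a::ab_group_add set)"
  obtains g :: "nat \<Rightarrow> 'a::ab_group_add" and T :: "nat \<Rightarrow> 'a set"
  where "\<And>n. 0 \<in> T n" "\<And>n x. x \<in> T n \<Longrightarrow> - x \<in> T n"
    "\<And>n x y. x \<in> T n \<Longrightarrow> y \<in> T n \<Longrightarrow> x + y \<in> T (Suc n)"
    "\<And>n. g n \<in> T (Suc n)" "\<And>n. g n \<notin> T n"
    "(\<forall>n. \<forall>x\<in>T n. x + x = 0) \<or> (\<forall>n. g n + g n \<notin> T n)"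
proof -
  define Q where "Q = (if infinite {x::'a. x + x = 0} then {x::'a. x + x = 0} else UNIV)"
  have Q0: "0 \<in> Q" by (simp add: Q_def)
  have Qneg: "- x \<in> Q" if "x \<in> Q" for x
    using that minus_unique [of x x] by (auto simp: Q_def split: if_splits)
  have Qadd: "x + y \<in> Q" if "x \<in> Q" "y \<in> Q" for x y
    using that by (auto simp: Q_def add.assoc split: if_splits) (metis add.left_commute add.right_neutral)
  have ex: "\<exists>x\<in>Q. x \<notin> F \<and> (infinite {x::'a. x + x = 0} \<or> x + x \<notin> F)" if F: "finite F" for F
  proof (cases "infinite {x::'a. x + x = 0}")
    case True
    then show ?thesis using F by (metis Q_def finite_subset subsetI)
  next
    case False
    have "finite {x. x + x = y}" for y :: 'a
    proof (cases "{x. x + x = y} = {}")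
      case False
      then obtain z where z: "z + z = y" by auto
      \<comment> \<open>A nonempty fibre of doubling is a coset of the 2-torsion subgroup, which is
        finite in this case.\<close>
      have "{x. x + x = y} \<subseteq> (\<lambda>x. x + z) ` {x. x + x = 0}"
      proof
        fix x assume "x \<in> {x. x + x = y}"
        then have "x - z + (x - z) = 0" using z by (simp add: algebra_simps)
        then show "x \<in> (\<lambda>x. x + z) ` {x. x + x = 0}" by (intro image_eqI [of _ _ "x - z"]) auto
      qed
      then show ?thesis using \<open>\<not> infinite {x::'a. x + x = 0}\<close> by (meson finite_imageI finite_subset)
    qed simp
    then have "finite (\<Union>y\<in>F. {x. x + x = y})" using F by blast
    then have "finite (F \<union> (\<Union>y\<in>F. {x. x + x = y}))" using F by blast
    then obtain x where "x \<notin> F \<union> (\<Union>y\<in>F. {x. x + x = y})" using assms by (metis ex_new_if_finite)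
    then show ?thesis using False by (auto simp: Q_def)
  qed
  define pick where "pick F = (SOME x. x \<in> Q \<and> x \<notin> F \<and> (infinite {x::'a. x + x = 0} \<or> x + x \<notin> F))"
    for F :: "'a set"
  have pick: "pick F \<in> Q \<and> pick F \<notin> F \<and> (infinite {x::'a. x + x = 0} \<or> pick F + pick F \<notin> F)"
    if "finite F" for F
    unfolding pick_def by (rule someI_ex) (use ex [OF that] in blast)
  define G where "G F = insert (pick F) (insert (- pick F) F)" for F
  define T where "T = rec_nat {0} (\<lambda>_ F. (\<lambda>(x, y). x + y) ` (G F \<times> G F))"
  have T0: "T 0 = {0}" and TS: "T (Suc n) = (\<lambda>(x, y). x + y) ` (G (T n) \<times> G (T n))" for n
    by (simp_all add: T_def)
  have fin: "finite (T n)" for n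
    by (induction n) (auto simp: T0 TS G_def)
  have zero: "0 \<in> T n" for n
    by (induction n) (force simp: T0 TS G_def)+
  have GT: "x + y \<in> T (Suc n)" if "x \<in> G (T n)" "y \<in> G (T n)" for n x y
    using that by (force simp: TS)
  have neg: "- x \<in> T n" if "x \<in> T n" for n x
    using that
  proof (induction n arbitrary: x)
    case (Suc n)
    then obtain a b where ab: "a \<in> G (T n)" "b \<in> G (T n)" "x = a + b" by (auto simp: TS)
    have "- a \<in> G (T n)" "- b \<in> G (T n)" using ab Suc.IH by (auto simp: G_def)
    then show ?case using GT [of "- a" n "- b"] ab by simp
  qed (simp add: T0)
  have TQ: "T n \<subseteq> Q" for n
  proof (induction n)
    case (Suc n)
    then have "G (T n) \<subseteq> Q" using pick [OF fin] Qneg by (auto simp: G_def)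
    then show ?case using Qadd by (auto simp: TS)
  qed (simp add: T0 Q0)
  show thesis
  proof (rule that [of T "\<lambda>n. pick (T n)"])
    show "pick (T n) \<in> T (Suc n)" for n
      using GT [of "pick (T n)" n 0] zero [of n] by (simp add: G_def)
    show "(\<forall>n. \<forall>x\<in>T n. x + x = 0) \<or> (\<forall>n. pick (T n) + pick (T n) \<notin> T n)"
    proof (cases "infinite {x::'a. x + x = 0}")
      case True
      then show ?thesis using TQ by (auto simp: Q_def)
    next
      case False
      then show ?thesis using pick [OF fin] by blast
    qed
  qed (use pick fin zero neg GT in \<open>auto simp: G_def\<close>)
qed

primrec riesz_span :: "(nat \<Rightarrow> 'a::ab_group_add) \<Rightarrow> nat \<Rightarrow> 'a set" where
  "riesz_span d 0 = {0}"
| "riesz_span d (Suc n) = (\<Union>s\<in>riesz_span d n. {s, s + d n, s - d n})"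

lemma riesz_span_zero [simp]: "0 \<in> riesz_span d n"
  by (induction n) auto

lemma riesz_span_minus: "s \<in> riesz_span d n \<Longrightarrow> - s \<in> riesz_span d n"
proof (induction n arbitrary: s)
  case (Suc n)
  then obtain t where t: "t \<in> riesz_span d n" "s \<in> {t, t + d n, t - d n}" by auto
  then have "- t \<in> riesz_span d n" using Suc.IH by blast
  moreover have "- s \<in> {- t, - t + d n, - t - d n}" using t by auto
  ultimately show ?case by (simp only: riesz_span.simps UN_iff) blast
qed simp

lemma riesz_span_mono: "m \<le> n \<Longrightarrow> riesz_span d m \<subseteq> riesz_span d n"
  by (rule lift_Suc_mono_le [of "riesz_span d"]) auto

lemma riesz_span_generator: "d n \<in> riesz_span d (Suc n)"
  by (auto intro!: bexI [of _ 0])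

text \<open>The span is the Fourier support of the finite Riesz products with generators \<open>d\<close>. Only sums of
  two elements of the span have to be avoided, since the largest index in a relation is unique.
  Generators of order two are admitted.\<close>

definition dissociate :: "(nat \<Rightarrow> 'a::ab_group_add) \<Rightarrow> bool" where
  "dissociate d \<longleftrightarrow>
     (\<forall>n. \<forall>s\<in>riesz_span d n. \<forall>t\<in>riesz_span d n. d n \<noteq> s + t) \<and>
     (\<forall>n. d n + d n = 0 \<or> d n + d n \<notin> riesz_span d n)"

lemma dissociate_notin:
  assumes "dissociate d" "s \<in> riesz_span d n" "t \<in> riesz_span d n"
  shows "d n \<noteq> s + t" "d n \<noteq> s - t" "d n \<noteq> s"
proof -
  show *: "d n \<noteq> s + t" using assms by (simp add: dissociate_def)
  show "d n \<noteq> s - t" using assms riesz_span_minus [OF assms(3)] unfolding dissociate_def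
    by (metis add_uminus_conv_diff)
  show "d n \<noteq> s" using assms unfolding dissociate_def by (metis add.right_neutral riesz_span_zero)
qed

text \<open>The \<open>r k\<close> repeat and satisfy additive relations among themselves, so
  comparing levels does not suffice when \<open>d k\<close> and \<open>d k + r k\<close> occur
  together. There the argument rests on the fact that no \<open>r k\<close> lies in the span of
  either sequence (\<open>rd\<close>, \<open>re\<close>).\<close>

lemma two_dissociate_sequences:
  assumes "infinite (UNIV :: 'a::ab_group_add set)"
  obtains c d r :: "nat \<Rightarrow> 'a::ab_group_add"
  where "\<And>i j. i < j \<Longrightarrow> \<exists>k. r k = c i - c j"
    "dissociate d" "dissociate (\<lambda>k. d k + r k)"
    "\<And>k n. d k + r k \<notin> riesz_span d n" "\<And>k n. d k \<notin> riesz_span (\<lambda>k. d k + r k) n"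
proof (rule sparse_sequence [OF assms])
  fix g :: "nat \<Rightarrow> 'a" and T :: "nat \<Rightarrow> 'a set"
  assume zero: "\<And>n. 0 \<in> T n" and neg: "\<And>n x. x \<in> T n \<Longrightarrow> - x \<in> T n"
    and add: "\<And>n x y. x \<in> T n \<Longrightarrow> y \<in> T n \<Longrightarrow> x + y \<in> T (Suc n)"
    and gin: "\<And>n. g n \<in> T (Suc n)" and gout: "\<And>n. g n \<notin> T n"
    and two: "(\<forall>n. \<forall>x\<in>T n. x + x = 0) \<or> (\<forall>n. g n + g n \<notin> T n)"
  have "T n \<subseteq> T (Suc n)" for n using add [of _ n 0] zero by auto
  then have "T m \<subseteq> T n" if "m \<le> n" for m n using that lift_Suc_mono_le by blast
  then have mono: "x \<in> T n" if "x \<in> T m" "m \<le> n" for m n x using that by blast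
  have add': "x + y \<in> T n" if "x \<in> T k" "y \<in> T l" "k < n" "l < n" for x y k l n
    using add [of x "n - 1" y] mono [of x k "n - 1"] mono [of y l "n - 1"] that by (cases n) auto
  have diff': "x - y \<in> T n" if "x \<in> T k" "y \<in> T l" "k < n" "l < n" for x y k l n
    using add' [of x k "- y" l n] that neg by auto
  \<comment> \<open>Block \<open>k\<close> occupies eight levels. As \<open>b k \<le> Suc k\<close>,
    both terms of \<open>r k\<close> lie in \<open>T (8 * k + 10)\<close>, so \<open>r k\<close> is
    in \<open>T (8 * k + 11)\<close>. The index \<open>8 * k + 13\<close> of \<open>d k\<close>
    leaves room for the sums formed with \<open>r k\<close> below: they end at level
    \<open>8 * k + 13\<close> at most, where \<open>d k\<close> is still new. The span including
    \<open>d k\<close> or \<open>d k + r k\<close> is then reached at level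
    \<open>8 * k + 16\<close>, the start of the next block.\<close>
  define c where "c i = g (8 * i + 1)" for i
  define d where "d k = g (8 * k + 13)" for k
  define a where "a k = fst (prod_decode k)" for k
  \<comment> \<open>All pairs are enumerated; a pair that is not increasing is replaced by
    \<open>(a k, Suc (a k))\<close>, so that every \<open>r k\<close> is a difference with
    \<open>a k < b k\<close>.\<close>
  define b where "b k = (if a k < snd (prod_decode k) then snd (prod_decode k) else Suc (a k))" for k
  define r where "r k = c (a k) - c (b k)" for k
  have ab: "a k < b k" "b k \<le> Suc k" for k
    using le_prod_encode_1 [of "fst (prod_decode k)" "snd (prod_decode k)"]
      le_prod_encode_2 [of "snd (prod_decode k)" "fst (prod_decode k)"]
    by (auto simp: a_def b_def)
  have cT: "c i \<in> T n" if "8 * i + 2 \<le> n" for i n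
    unfolding c_def by (rule mono [OF gin]) (use that in simp)
  have cno: "c i \<notin> T (8 * i + 1)" for i using gout by (simp add: c_def)
  have dT: "d i \<in> T (8 * i + 14)" for i using gin [of "8 * i + 13"] by (simp add: d_def add.commute)
  have dno: "d i \<notin> T n" if "n \<le> 8 * i + 13" for i n using gout mono that by (auto simp: d_def)
  have rT: "r k \<in> T (8 * k + 11)" for k
    unfolding r_def using ab [of k] by (intro diff' [OF cT cT, of _ "8 * k + 10" _ "8 * k + 10"]) auto
  define e where "e k = d k + r k" for k
  have eT: "e k \<in> T (8 * k + 15)" for k
    unfolding e_def by (rule add' [OF dT rT]) auto
  have dS: "riesz_span d n \<subseteq> T (8 * n + 8)" for n
  proof (induction n)
    case (Suc n)
    then have s: "s \<in> T (8 * n + 8)" if "s \<in> riesz_span d n" for s using that by blast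
    have "{s, s + d n, s - d n} \<subseteq> T (8 * n + 16)" if "s \<in> riesz_span d n" for s
      using mono [OF s [OF that]] add' [OF s [OF that] dT [of n]] diff' [OF s [OF that] dT [of n]] by auto
    then show ?case by (auto simp: add.commute)
  qed (simp add: zero)
  have eS: "riesz_span e n \<subseteq> T (8 * n + 8)" for n
  proof (induction n)
    case (Suc n)
    then have s: "s \<in> T (8 * n + 8)" if "s \<in> riesz_span e n" for s using that by blast
    have "{s, s + e n, s - e n} \<subseteq> T (8 * n + 16)" if "s \<in> riesz_span e n" for s
      using mono [OF s [OF that]] add' [OF s [OF that] eT [of n]] diff' [OF s [OF that] eT [of n]] by auto
    then show ?case by (auto simp: add.commute)
  qed (simp add: zero)
  \<comment> \<open>The later term dominates: \<open>c j = c i - (c i - c j)\<close> would have too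
    low a level.\<close>
  have late: "c i - c j \<notin> T (8 * n + 8)" if "i < j" "n < j" for i j n
  proof
    assume *: "c i - c j \<in> T (8 * n + 8)"
    have "c i - (c i - c j) \<in> T (8 * j + 1)"
      using that by (intro diff' [OF cT * ]) (auto intro: order_refl)
    then show False using cno [of j] by simp
  qed
  \<comment> \<open>For \<open>Suc n < j\<close> the span lies too low to contain the difference.
    From then on the difference lies too low to involve \<open>d n\<close>: a representation using
    \<open>d n\<close> would express it by elements of \<open>T (8 * n + 11)\<close>.\<close>
  have rd: "c i - c j \<notin> riesz_span d n" if ij: "i < j" for i j n
  proof (induction n)
    case 0
    then show ?case using late [OF ij, of 0] ij dS [of 0] by auto
  next
    case (Suc n)
    show ?case
    proof (cases "Suc n < j")
      case True
      then show ?thesis using late [OF ij] dS by blast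
    next
      case False
      have *: "c i - c j \<in> T (8 * n + 11)"
        using False ij by (intro diff' [OF cT cT, of _ "8 * n + 10" _ "8 * n + 10"]) auto
      show ?thesis
      proof
        assume "c i - c j \<in> riesz_span d (Suc n)"
        then obtain s where s: "s \<in> riesz_span d n" and "c i - c j \<in> {s, s + d n, s - d n}" by auto
        with Suc have "d n = (c i - c j) - s \<or> d n = s - (c i - c j)" by auto
        moreover have "s \<in> T (8 * n + 8)" using s dS by blast
        ultimately have "d n \<in> T (8 * n + 12)" using diff' [OF *, of s] diff' [OF _ *, of s] by auto
        then show False using dno [of "8 * n + 12" n] by simp
      qed
    qed
  qed
  have re: "c i - c j \<notin> riesz_span e n" if ij: "i < j" for i j n
  proof (induction n)
    case 0
    then show ?case using late [OF ij, of 0] ij eS [of 0] by auto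
  next
    case (Suc n)
    show ?case
    proof (cases "Suc n < j")
      case True
      then show ?thesis using late [OF ij] eS by blast
    next
      case False
      have *: "c i - c j \<in> T (8 * n + 11)"
        using False ij by (intro diff' [OF cT cT, of _ "8 * n + 10" _ "8 * n + 10"]) auto
      show ?thesis
      proof
        assume "c i - c j \<in> riesz_span e (Suc n)"
        then obtain s where s: "s \<in> riesz_span e n" and "c i - c j \<in> {s, s + e n, s - e n}" by auto
        with Suc have "e n = (c i - c j) - s \<or> e n = s - (c i - c j)" by auto
        moreover have "s \<in> T (8 * n + 8)" using s eS by blast
        ultimately have "e n \<in> T (8 * n + 12)" using diff' [OF *, of s] diff' [OF _ *, of s] by auto
        then have "e n - r n \<in> T (8 * n + 13)" by (rule diff' [OF _ rT]) auto
        then show False using dno [of "8 * n + 13" n] by (simp add: e_def)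
      qed
    qed
  qed
  have two': "d k + d k \<notin> T (8 * k + 13)" if "\<not> (\<forall>n. \<forall>x\<in>T n. x + x = 0)" for k
    using two that by (auto simp: d_def)
  have dd: "dissociate d"
    unfolding dissociate_def
  proof (intro conjI allI ballI)
    fix n s t assume "s \<in> riesz_span d n" "t \<in> riesz_span d n"
    then have "s + t \<in> T (8 * n + 9)" using dS by (intro add' [of _ "8 * n + 8" _ "8 * n + 8"]) auto
    then show "d n \<noteq> s + t" using dno [of "8 * n + 9" n] by auto
  next
    fix n
    show "d n + d n = 0 \<or> d n + d n \<notin> riesz_span d n"
      using two' [of n] dS [of n] mono [of "d n + d n" "8 * n + 8" "8 * n + 13"] dT [of n] by auto
  qed
  have de: "dissociate e"
    unfolding dissociate_def
  proof (intro conjI allI ballI)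
    fix n s t assume "s \<in> riesz_span e n" "t \<in> riesz_span e n"
    then have "s + t \<in> T (8 * n + 9)" using eS by (intro add' [of _ "8 * n + 8" _ "8 * n + 8"]) auto
    then have "s + t - r n \<in> T (8 * n + 12)" by (rule diff' [OF _ rT]) auto
    then have "d n \<in> T (8 * n + 12)" if "e n = s + t"
      using that by (metis add_diff_cancel_right' e_def)
    then show "e n \<noteq> s + t" using dno [of "8 * n + 12" n] by auto
  next
    fix n
    have "e n + e n \<notin> riesz_span e n" if "\<not> (\<forall>n. \<forall>x\<in>T n. x + x = 0)"
    proof
      assume "e n + e n \<in> riesz_span e n"
      then have "e n + e n - (r n + r n) \<in> T (8 * n + 13)"
        using eS by (intro diff' [of _ "8 * n + 8" _ "8 * n + 12"] add' [OF rT rT]) auto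
      then show False using two' [OF that] by (simp add: e_def algebra_simps)
    qed
    then show "e n + e n = 0 \<or> e n + e n \<notin> riesz_span e n" using eT [of n] by blast
  qed
  have ed: "e k \<notin> riesz_span d n" for k n
  proof (induction n)
    case 0
    have "0 - r k \<in> T (8 * k + 12)" by (rule diff' [OF zero [of 0] rT]) auto
    then show ?case using dno [of "8 * k + 12" k] by (auto simp: e_def add_eq_0_iff2)
  next
    case (Suc n)
    consider "n < k" | "n = k" | "k < n" by linarith
    then show ?case
    proof cases
      case 1
      show ?thesis
      proof
        assume "e k \<in> riesz_span d (Suc n)"
        then have "e k \<in> T (8 * Suc n + 8)" using dS by blast
        then have "e k \<in> T (8 * k + 8)" by (rule mono) (use 1 in simp)
        then have "e k - r k \<in> T (8 * k + 12)" by (rule diff' [OF _ rT]) auto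
        then show False using dno [of "8 * k + 12" k] by (auto simp: e_def)
      qed
    next
      \<comment> \<open>The critical case. From \<open>e k = s + d k\<close> follows
        \<open>r k = s\<close>, excluded by \<open>rd\<close>. From \<open>e k = s - d k\<close>
        follows \<open>d k + d k = s - r k\<close>, whose level is so low that the doubling
        alternative must be the one with exponent two; then \<open>d k + d k = 0\<close> and again
        \<open>r k = s\<close>.\<close>
      case 2
      have r: "r k \<notin> riesz_span d n" unfolding r_def by (rule rd [OF ab(1)])
      show ?thesis
      proof
        assume "e k \<in> riesz_span d (Suc n)"
        then obtain s where s: "s \<in> riesz_span d n" and "e k \<in> {s, s + d n, s - d n}" by auto
        with Suc 2 have "r k = s \<or> d k + d k + r k = s" by (auto simp: e_def algebra_simps)
        with r s have *: "d k + d k = s - r k" "r k \<noteq> s" by (auto simp: algebra_simps)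
        have "s - r k \<in> T (8 * k + 13)" using s dS 2 by (intro diff' [OF _ rT, of _ "8 * k + 8"]) auto
        then have "\<forall>n. \<forall>x\<in>T n. x + x = 0" using two' [of k] * by metis
        then have "d k + d k = 0" using dT by blast
        then show False using * by simp
      qed
    next
      case 3
      have ek: "e k \<in> T (8 * n + 8)" using eT 3 by (rule_tac mono) auto
      show ?thesis
      proof
        assume "e k \<in> riesz_span d (Suc n)"
        then obtain s where s: "s \<in> riesz_span d n" and "e k \<in> {s, s + d n, s - d n}" by auto
        with Suc have "d n = e k - s \<or> d n = s - e k" by (auto simp: algebra_simps)
        moreover have "s \<in> T (8 * n + 8)" using s dS by blast
        ultimately have "d n \<in> T (8 * n + 9)" using diff' [OF ek, of s] diff' [OF _ ek, of s] by auto
        then show False using dno [of "8 * n + 9" n] by simp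
      qed
    qed
  qed
  have nde: "d k \<notin> riesz_span e n" for k n
  proof (induction n)
    case 0
    show ?case using dno [of 0 k] zero [of 0] by auto
  next
    case (Suc n)
    consider "n < k" | "n = k" | "k < n" by linarith
    then show ?case
    proof cases
      case 1
      then have "d k \<notin> T (8 * Suc n + 8)" by (intro dno) simp
      then show ?thesis using eS by blast
    next
      case 2
      have r: "r k \<notin> riesz_span e n" unfolding r_def by (rule re [OF ab(1)])
      \<comment> \<open>Now the sign matters: \<open>d k = s + e k\<close> makes \<open>s\<close>
        equal to \<open>- r k\<close>.\<close>
      then have r': "- r k \<notin> riesz_span e n" using riesz_span_minus [of "- r k" e n] by auto
      show ?thesis
      proof
        assume "d k \<in> riesz_span e (Suc n)"
        then obtain s where s: "s \<in> riesz_span e n" and "d k \<in> {s, s + e n, s - e n}" by auto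
        moreover have "d k \<noteq> s" using Suc s by blast
        ultimately have "s + (d k + r k) = d k \<or> s - (d k + r k) = d k" using 2 by (auto simp: e_def)
        moreover have "- r k = s" if "s + (d k + r k) = d k"
        proof -
          have "d k + (s + r k) = d k" using that by (simp add: add.left_commute)
          then have "s + r k = 0" by simp
          then show ?thesis by (metis add.inverse_inverse eq_neg_iff_add_eq_0)
        qed
        ultimately have "- r k = s \<or> d k + d k + r k = s" by (auto simp: algebra_simps)
        with r r' s have *: "d k + d k = s - r k" "r k \<noteq> s" by (auto simp: algebra_simps)
        have "s - r k \<in> T (8 * k + 13)" using s eS 2 by (intro diff' [OF _ rT, of _ "8 * k + 8"]) auto
        then have "\<forall>n. \<forall>x\<in>T n. x + x = 0" using two' [of k] * by metis
        then have "d k + d k = 0" using dT by blast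
        then show False using * by simp
      qed
    next
      case 3
      have dk: "d k \<in> T (8 * n + 8)" using dT 3 by (rule_tac mono) auto
      show ?thesis
      proof
        assume "d k \<in> riesz_span e (Suc n)"
        then obtain s where s: "s \<in> riesz_span e n" and "d k \<in> {s, s + e n, s - e n}" by auto
        with Suc have "e n = d k - s \<or> e n = s - d k" by (auto simp: algebra_simps)
        moreover have "s \<in> T (8 * n + 8)" using s eS by blast
        ultimately have "e n \<in> T (8 * n + 9)" using diff' [OF dk, of s] diff' [OF _ dk, of s] by auto
        then have "e n - r n \<in> T (8 * n + 12)" by (rule diff' [OF _ rT]) auto
        then show False using dno [of "8 * n + 12" n] by (simp add: e_def)
      qed
    qed
  qed
  have "\<exists>k. r k = c i - c j" if "i < j" for i j
    using that by (intro exI [of _ "prod_encode (i, j)"]) (simp add: r_def a_def b_def)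
  then show thesis using that [of r c d] dd de ed nde unfolding e_def by blast
qed

subsection \<open>Characters and finite Riesz products\<close>

lemma dual_group_add: "x \<in> dual_group \<Longrightarrow> x (\<gamma> + \<delta>) = x \<gamma> * x \<delta>"
  and dual_group_norm: "x \<in> dual_group \<Longrightarrow> cmod (x \<gamma>) = 1"
  by (auto simp: dual_group_def)

lemma dual_group_zero: "x \<in> dual_group \<Longrightarrow> x 0 = 1"
  using dual_group_add [of x 0 0] dual_group_norm [of x 0]
  by (metis add_0 mult_cancel_right1 norm_zero zero_neq_one)

lemma dual_group_minus: assumes "x \<in> dual_group" shows "x (- \<gamma>) = cnj (x \<gamma>)"
proof -
  have "x (- \<gamma>) * x \<gamma> = 1" using dual_group_add [OF assms, of "- \<gamma>" \<gamma>] dual_group_zero [OF assms] by simp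
  moreover have "x \<gamma> * cnj (x \<gamma>) = 1" using dual_group_norm [OF assms] by (simp add: complex_norm_square [symmetric])
  ultimately show ?thesis by (metis mult.assoc mult.left_neutral mult.right_neutral)
qed

lemma dual_group_diff: "x \<in> dual_group \<Longrightarrow> x (\<gamma> - \<delta>) = x \<gamma> * cnj (x \<delta>)"
  using dual_group_add [of x \<gamma> "- \<delta>"] by (simp add: dual_group_minus)

lemma dual_group_mult: "x \<in> dual_group \<Longrightarrow> y \<in> dual_group \<Longrightarrow> (\<lambda>\<gamma>. x \<gamma> * y \<gamma>) \<in> dual_group"
  by (auto simp: dual_group_def norm_mult)

lemma dual_group_power: "x \<in> dual_group \<Longrightarrow> (\<lambda>\<gamma>. x \<gamma> ^ k) \<in> dual_group"
  by (auto simp: dual_group_def norm_power power_mult_distrib)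

text \<open>With integral vertical part, \<open>P\<close> is the graph of a homomorphism into the
  reals modulo 1, and \<open>cis (2 * pi * v)\<close> depends only on the class of
  \<open>v\<close>.\<close>

lemma character_of_graph:
  fixes P :: "('a::ab_group_add \<times> real) set"
  assumes P: "add_subgroup P" and dom: "fst ` P = UNIV" and int: "\<And>v. (0, v) \<in> P \<Longrightarrow> v \<in> \<int>"
  obtains x where "x \<in> dual_group" "\<And>\<gamma> v. (\<gamma>, v) \<in> P \<Longrightarrow> x \<gamma> = cis (2 * pi * v)"
proof -
  define u where "u \<gamma> = (SOME v. (\<gamma>, v) \<in> P)" for \<gamma>
  have u: "(\<gamma>, u \<gamma>) \<in> P" for \<gamma>
  proof -
    have "\<gamma> \<in> fst ` P" using dom by simp
    then have "\<exists>v. (\<gamma>, v) \<in> P" by (metis imageE prod.collapse)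
    then show ?thesis unfolding u_def by (rule someI_ex)
  qed
  have eq: "cis (2 * pi * u \<gamma>) = cis (2 * pi * v)" if "(\<gamma>, v) \<in> P" for \<gamma> v
  proof -
    have "(\<gamma>, u \<gamma>) - (\<gamma>, v) \<in> P" by (rule add_subgroup_diff [OF P u that])
    then have "u \<gamma> - v \<in> \<int>" using int by simp
    then have "cis (2 * pi * (u \<gamma> - v)) = 1" by (rule cis_multiple_2pi)
    moreover have "cis (2 * pi * u \<gamma>) = cis (2 * pi * (u \<gamma> - v)) * cis (2 * pi * v)"
      by (simp add: cis_mult algebra_simps)
    ultimately show ?thesis by simp
  qed
  have "cis (2 * pi * u (\<gamma> + \<delta>)) = cis (2 * pi * u \<gamma>) * cis (2 * pi * u \<delta>)" for \<gamma> \<delta>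
  proof -
    have "(\<gamma> + \<delta>, u \<gamma> + u \<delta>) \<in> P" using add_subgroup_add [OF P u u] by simp
    from eq [OF this] show ?thesis by (simp add: cis_mult algebra_simps)
  qed
  then have "(\<lambda>\<gamma>. cis (2 * pi * u \<gamma>)) \<in> dual_group" by (simp add: dual_group_def)
  then show thesis using that eq by blast
qed

text \<open>Not only must the character separate \<open>\<gamma>\<close> from 0: its value there is
  a root of unity, so that finitely many of its powers sum to exactly zero at
  \<open>\<gamma>\<close>.\<close>

lemma torsion_valued_character:
  fixes \<gamma> :: "'a::ab_group_add"
  assumes "\<gamma> \<noteq> 0"
  obtains x k where "x \<in> dual_group" "x \<gamma> \<noteq> 1" "0 < (k::nat)" "x \<gamma> ^ k = 1"
proof -
  have "add_subgroup {k. zmul k \<gamma> = 0}" by (simp add: add_subgroup_def zmul_diff)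
  then obtain n where n: "zmul n \<gamma> = 0" and dvd: "\<And>k. zmul k \<gamma> = 0 \<Longrightarrow> n dvd k"
    by (rule add_subgroup_int_generator) auto
  \<comment> \<open>The order of \<open>\<gamma>\<close>, or 2 if that order is infinite. The
    character sends \<open>\<gamma>\<close> to a primitive \<open>m\<close>-th root of
    unity.\<close>
  define m where "m = (if n = 0 then 2 else nat \<bar>n\<bar>)"
  have m: "2 \<le> m"
  proof -
    have "n \<noteq> 1" "n \<noteq> - 1" using n assms by (auto simp: zmul_minus)
    then show ?thesis by (auto simp: m_def)
  qed
  have dvdm: "int m dvd k" if "zmul k \<gamma> = 0" for k
    using dvd [OF that] by (auto simp: m_def)
  \<comment> \<open>The graph of \<open>zmul k \<gamma> \<mapsto> k / m\<close> modulo 1; the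
    summand \<open>l\<close> puts the integers into the vertical part.\<close>
  define P0 where "P0 = range (\<lambda>(k, l). (zmul k \<gamma>, real_of_int k / m + real_of_int l))"
  have "add_subgroup P0"
    unfolding add_subgroup_def
  proof (intro conjI ballI)
    show "0 \<in> P0" unfolding P0_def by (rule image_eqI [of _ _ "(0, 0)"]) (simp_all add: zero_prod_def)
    fix x y assume "x \<in> P0" "y \<in> P0"
    then obtain k l k' l' where "x = (zmul k \<gamma>, real_of_int k / m + real_of_int l)"
      "y = (zmul k' \<gamma>, real_of_int k' / m + real_of_int l')" by (auto simp: P0_def)
    then show "x - y \<in> P0" unfolding P0_def
      by (intro image_eqI [of _ _ "(k - k', l - l')"]) (simp_all add: zmul_diff diff_divide_distrib)
  qed
  then obtain P where P: "add_subgroup P" "P0 \<subseteq> P" "fst ` P = UNIV"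
    "\<And>v. (0, v) \<in> P \<Longrightarrow> (0, v) \<in> P0" by (rule divisible_extension) (erule that; blast)
  have "v \<in> \<int>" if v: "(0, v) \<in> P" for v
  proof -
    obtain k l where kl: "zmul k \<gamma> = 0" "v = real_of_int k / m + real_of_int l"
      using P(4) [OF v] by (auto simp: P0_def)
    obtain q where "k = int m * q" using dvdm [OF kl(1)] by auto
    then have "v = of_int (q + l)" using kl m by simp
    then show ?thesis by (metis Ints_of_int)
  qed
  then obtain x where x: "x \<in> dual_group" "\<And>\<gamma> v. (\<gamma>, v) \<in> P \<Longrightarrow> x \<gamma> = cis (2 * pi * v)"
    using character_of_graph [OF P(1,3)] by blast
  have "(\<gamma>, 1 / m) \<in> P0" unfolding P0_def by (rule image_eqI [of _ _ "(1, 0)"]) simp_all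
  then have xg: "x \<gamma> = cis (2 * pi / m)" using x(2) [of \<gamma> "1 / m"] P(2) by auto
  have "x \<gamma> ^ m = 1" using m by (simp add: xg Complex.DeMoivre)
  moreover have "x \<gamma> \<noteq> 1"
  proof
    assume "x \<gamma> = 1"
    then have "cos (2 * pi / m) = 1" by (simp add: xg complex_eq_iff)
    then obtain j :: int where "2 * pi / m = real_of_int j * 2 * pi" using cos_one_2pi_int by blast
    then have "1 = real_of_int (j * int m)" using m by (simp add: field_simps)
    then have "1 = j * int m" by linarith
    then have "int m dvd 1" by (metis dvd_triv_right)
    then show False using m by simp
  qed
  ultimately show thesis using that [of x m] x(1) m by auto
qed

text \<open>Replacing a list by its products with all \<open>z ^ j\<close>, \<open>j < k\<close>,
  multiplies its sum at every \<open>\<delta>\<close> by a geometric sum. This factor vanishes at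
  the new element, and earlier zeros persist. Lists record multiplicities, so coinciding products do
  no harm.\<close>

lemma averaging_characters:
  fixes F :: "'a::ab_group_add set"
  assumes "finite F"
  shows "\<exists>xs. xs \<noteq> [] \<and> set xs \<subseteq> dual_group \<and> (\<forall>\<gamma>\<in>F. \<gamma> \<noteq> 0 \<longrightarrow> (\<Sum>x\<leftarrow>xs. x \<gamma>) = 0)"
  using assms
proof (induction F rule: finite_induct)
  case empty
  have "(\<lambda>_. 1) \<in> dual_group" by (simp add: dual_group_def)
  then show ?case by (intro exI [of _ "[\<lambda>_. 1]"]) auto
next
  case (insert \<gamma> F)
  from insert.IH obtain xs where xs: "xs \<noteq> []" "set xs \<subseteq> dual_group"
    "\<forall>\<delta>\<in>F. \<delta> \<noteq> 0 \<longrightarrow> (\<Sum>x\<leftarrow>xs. x \<delta>) = 0" by (elim exE conjE) (rule that)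
  show ?case
  proof (cases "\<gamma> = 0")
    case True
    then show ?thesis using xs by (intro exI [of _ xs]) auto
  next
    case False
    then obtain z k where z: "z \<in> dual_group" "z \<gamma> \<noteq> 1" "0 < k" "z \<gamma> ^ k = 1"
      by (rule torsion_valued_character)
    define ys where "ys = concat (map (\<lambda>j. map (\<lambda>x \<delta>. z \<delta> ^ j * x \<delta>) xs) [0..<k])"
    have "(\<Sum>y\<leftarrow>concat (map (\<lambda>j. map (\<lambda>x \<delta>. z \<delta> ^ j * x \<delta>) xs) [0..<n]). y \<delta>)
        = (\<Sum>j<n. z \<delta> ^ j) * (\<Sum>x\<leftarrow>xs. x \<delta>)" for n \<delta>
      by (induction n) (simp_all add: o_def sum_list_const_mult ring_distribs)
    then have sum: "(\<Sum>y\<leftarrow>ys. y \<delta>) = (\<Sum>j<k. z \<delta> ^ j) * (\<Sum>x\<leftarrow>xs. x \<delta>)" for \<delta>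
      by (simp add: ys_def)
    have "(\<Sum>j<k. z \<gamma> ^ j) = 0" using z by (simp add: geometric_sum)
    moreover have "set ys \<subseteq> dual_group"
      using xs(2) by (auto simp: ys_def intro!: dual_group_mult dual_group_power z)
    moreover have "ys \<noteq> []" using xs(1) z(3) by (auto simp: ys_def)
    ultimately show ?thesis using xs(3) by (intro exI [of _ ys]) (auto simp: sum)
  qed
qed

text \<open>The mean of \<open>riesz_product c d n x * x \<gamma>\<close> under normalised Haar
  measure, computed formally: the last factor is expanded with
  \<open>Re z = (z + cnj z) / 2\<close>.\<close>

primrec riesz_coeff :: "(nat \<Rightarrow> real) \<Rightarrow> (nat \<Rightarrow> 'a::ab_group_add) \<Rightarrow> nat \<Rightarrow> 'a \<Rightarrow> real" where
  "riesz_coeff c d 0 \<gamma> = of_bool (\<gamma> = 0)"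
| "riesz_coeff c d (Suc n) \<gamma> = riesz_coeff c d n \<gamma> +
     c n / 2 * (riesz_coeff c d n (\<gamma> + d n) + riesz_coeff c d n (\<gamma> - d n))"

lemma riesz_coeff_support: "\<gamma> \<notin> riesz_span d n \<Longrightarrow> riesz_coeff c d n \<gamma> = 0"
proof (induction n arbitrary: \<gamma>)
  case (Suc n)
  have *: "s \<in> riesz_span d n \<Longrightarrow> \<gamma> \<notin> {s, s + d n, s - d n}" for s using Suc.prems by auto
  have "\<gamma> \<notin> riesz_span d n" "\<gamma> + d n \<notin> riesz_span d n" "\<gamma> - d n \<notin> riesz_span d n"
    using * [of \<gamma>] * [of "\<gamma> + d n"] * [of "\<gamma> - d n"] by auto
  then show ?case using Suc.IH by simp
qed simp

lemma riesz_coeff_at_zero: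
  assumes "dissociate d"
  shows "riesz_coeff c d n 0 = 1"
proof (induction n)
  case (Suc n)
  have "d n \<notin> riesz_span d n" using dissociate_notin(3) [OF assms] riesz_span_zero by metis
  moreover from this have "- d n \<notin> riesz_span d n" using riesz_span_minus by fastforce
  ultimately show ?case using Suc by (simp add: riesz_coeff_support)
qed simp

text \<open>The factor with index \<open>k\<close> contributes \<open>c k / 2\<close> through
  \<open>d k - d k = 0\<close>, and the same amount again through \<open>d k + d k\<close> exactly
  when that is 0. Later factors contribute nothing, because \<open>d k + d n\<close> and
  \<open>d k - d n\<close> avoid the earlier span.\<close>

lemma riesz_coeff_at_generator:
  assumes "dissociate d" "k < n"
  shows "riesz_coeff c d n (d k) = c k * (if d k + d k = 0 then 1 else 1 / 2)"
  using assms(2)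
proof (induction n)
  case (Suc n)
  show ?case
  proof (cases "k = n")
    case True
    have "d n \<notin> riesz_span d n" using dissociate_notin(3) [OF assms(1)] riesz_span_zero by metis
    moreover have "riesz_coeff c d n (d n + d n) = of_bool (d n + d n = 0)"
      using assms(1) by (auto simp: dissociate_def riesz_coeff_at_zero [OF assms(1)] riesz_coeff_support)
    ultimately show ?thesis
      using True by (simp add: riesz_coeff_support riesz_coeff_at_zero [OF assms(1)])
  next
    case False
    then have "k < n" using Suc.prems by simp
    then have k: "d k \<in> riesz_span d n"
      using riesz_span_generator [of d k] riesz_span_mono [of "Suc k" n d] by auto
    have "d k + d n \<notin> riesz_span d n"
    proof
      assume "d k + d n \<in> riesz_span d n"
      then show False using dissociate_notin(2) [OF assms(1) _ k, of "d k + d n"] by simp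
    qed
    moreover have "d k - d n \<notin> riesz_span d n"
    proof
      assume "d k - d n \<in> riesz_span d n"
      then show False using dissociate_notin(2) [OF assms(1) k, of "d k - d n"] by simp
    qed
    ultimately show ?thesis using Suc.IH \<open>k < n\<close> by (simp add: riesz_coeff_support)
  qed
qed simp

definition riesz_product :: "(nat \<Rightarrow> real) \<Rightarrow> (nat \<Rightarrow> 'a) \<Rightarrow> nat \<Rightarrow> ('a \<Rightarrow> complex) \<Rightarrow> real" where
  "riesz_product c d n x = (\<Prod>j<n. 1 + c j * Re (x (d j)))"

text \<open>Only finitely many group elements occur in the expansion, so a list of characters whose
  sums vanish at the nonzero ones cannot be told from Haar measure here. The set \<open>F'\<close>
  is fixed before the list, so the list can then be chosen for it.\<close>

lemma riesz_product_average:
  fixes F :: "'a::ab_group_add set"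
  assumes "finite F"
  shows "\<exists>F'. finite F' \<and> (\<forall>xs. set xs \<subseteq> dual_group \<longrightarrow>
    (\<forall>\<delta>\<in>F'. \<delta> \<noteq> 0 \<longrightarrow> (\<Sum>x\<leftarrow>xs. x \<delta>) = 0) \<longrightarrow>
    (\<forall>\<gamma>\<in>F. (\<Sum>x\<leftarrow>xs. of_real (riesz_product c d n x) * x \<gamma>)
      = of_nat (length xs) * of_real (riesz_coeff c d n \<gamma>)))"
  using assms
proof (induction n arbitrary: F)
  case 0
  have sum: "(\<Sum>x\<leftarrow>xs. x \<gamma>) = of_nat (length xs) * of_bool (\<gamma> = 0)"
    if "set xs \<subseteq> dual_group" "\<gamma> \<noteq> 0 \<longrightarrow> (\<Sum>x\<leftarrow>xs. x \<gamma>) = 0" for xs and \<gamma> :: 'a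
  proof (cases "\<gamma> = 0")
    case True
    have "(\<Sum>x\<leftarrow>xs. x (0::'a)) = of_nat (length xs)"
      using that(1) by (induction xs) (auto simp: dual_group_zero)
    then show ?thesis using True by simp
  qed (use that in simp)
  have "(\<Sum>x\<leftarrow>xs. of_real (riesz_product c d 0 x) * x \<gamma>)
      = of_nat (length xs) * of_real (riesz_coeff c d 0 \<gamma>)"
    if "set xs \<subseteq> dual_group" "\<gamma> \<noteq> 0 \<longrightarrow> (\<Sum>x\<leftarrow>xs. x \<gamma>) = 0" for xs and \<gamma> :: 'a
    using sum [OF that] by (simp add: riesz_product_def)
  then show ?case using 0 by blast
next
  case (Suc n)
  define F2 where "F2 = F \<union> (\<lambda>\<gamma>. \<gamma> + d n) ` F \<union> (\<lambda>\<gamma>. \<gamma> - d n) ` F"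
  have "finite F2" using Suc.prems by (simp add: F2_def)
  from Suc.IH [OF this] obtain F' where F': "finite F'"
    and "\<forall>xs. set xs \<subseteq> dual_group \<longrightarrow> (\<forall>\<delta>\<in>F'. \<delta> \<noteq> 0 \<longrightarrow> (\<Sum>x\<leftarrow>xs. x \<delta>) = 0) \<longrightarrow>
      (\<forall>\<gamma>\<in>F2. (\<Sum>x\<leftarrow>xs. of_real (riesz_product c d n x) * x \<gamma>)
        = of_nat (length xs) * of_real (riesz_coeff c d n \<gamma>))" by (elim exE conjE) (rule that)
  then have avg: "(\<Sum>x\<leftarrow>xs. of_real (riesz_product c d n x) * x \<gamma>)
      = of_nat (length xs) * of_real (riesz_coeff c d n \<gamma>)"
    if "set xs \<subseteq> dual_group" "\<forall>\<delta>\<in>F'. \<delta> \<noteq> 0 \<longrightarrow> (\<Sum>x\<leftarrow>xs. x \<delta>) = 0" "\<gamma> \<in> F2" for xs \<gamma>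
    using that by blast
  have "(\<Sum>x\<leftarrow>xs. of_real (riesz_product c d (Suc n) x) * x \<gamma>)
      = of_nat (length xs) * of_real (riesz_coeff c d (Suc n) \<gamma>)"
    if xs: "set xs \<subseteq> dual_group" "\<forall>\<delta>\<in>F'. \<delta> \<noteq> 0 \<longrightarrow> (\<Sum>x\<leftarrow>xs. x \<delta>) = 0" and \<gamma>: "\<gamma> \<in> F" for xs \<gamma>
  proof -
    let ?S = "\<lambda>\<gamma>. \<Sum>x\<leftarrow>xs. of_real (riesz_product c d n x) * x \<gamma>"
    have "(\<Sum>x\<leftarrow>xs. of_real (riesz_product c d (Suc n) x) * x \<gamma>)
        = ?S \<gamma> + of_real (c n / 2) * (?S (\<gamma> + d n) + ?S (\<gamma> - d n))"
      using xs(1)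
    proof (induction xs)
      case (Cons x xs)
      have x: "x \<in> dual_group" using Cons.prems by simp
      have re: "complex_of_real (Re (x (d n))) = (x (d n) + cnj (x (d n))) / 2"
        by (simp add: complex_add_cnj)
      have "of_real (riesz_product c d (Suc n) x) * x \<gamma> = of_real (riesz_product c d n x) * x \<gamma>
        + of_real (c n / 2) * (of_real (riesz_product c d n x) * x (\<gamma> + d n)
          + of_real (riesz_product c d n x) * x (\<gamma> - d n))"
        using x by (simp add: riesz_product_def re dual_group_add dual_group_diff algebra_simps)
      moreover note Cons.IH
      ultimately show ?case using Cons.prems by (simp add: algebra_simps)
    qed simp
    also have "\<dots> = of_nat (length xs) * of_real (riesz_coeff c d (Suc n) \<gamma>)"
      using avg [OF xs, of \<gamma>] avg [OF xs, of "\<gamma> + d n"] avg [OF xs, of "\<gamma> - d n"] \<gamma>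
      by (simp add: F2_def algebra_simps)
    finally show ?thesis .
  qed
  then show ?case using F' by blast
qed

text \<open>Integration against a finitely supported measure. Points may repeat in the list, and the
  value type is general so that total mass and complex coefficients are both covered.\<close>

definition weighted_sum :: "(real \<times> 'b) list \<Rightarrow> ('b \<Rightarrow> 'c::real_vector) \<Rightarrow> 'c" where
  "weighted_sum L f = (\<Sum>(w, x)\<leftarrow>L. w *\<^sub>R f x)"

definition finite_prob :: "(real \<times> 'b) list \<Rightarrow> bool" where
  "finite_prob L \<longleftrightarrow> (\<forall>(w, x)\<in>set L. 0 \<le> w) \<and> weighted_sum L (\<lambda>_. 1::real) = 1"

lemma finite_riesz_measure:
  fixes F :: "'a::ab_group_add set"
  assumes "finite F" "dissociate d" "\<And>j. \<bar>c j\<bar> \<le> 1"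
  obtains L where "finite_prob L" "snd ` set L \<subseteq> dual_group"
    "\<And>\<gamma>. \<gamma> \<in> F \<Longrightarrow> weighted_sum L (\<lambda>x. x \<gamma>) = complex_of_real (riesz_coeff c d n \<gamma>)"
proof -
  \<comment> \<open>The element 0 is included to obtain the total mass, which is the coefficient at
    0.\<close>
  have "finite (insert 0 F)" using assms(1) by simp
  from riesz_product_average [OF this, of c d n] obtain F' where F': "finite F'"
    "\<forall>xs. set xs \<subseteq> dual_group \<longrightarrow> (\<forall>\<delta>\<in>F'. \<delta> \<noteq> 0 \<longrightarrow> (\<Sum>x\<leftarrow>xs. x \<delta>) = 0) \<longrightarrow>
      (\<forall>\<gamma>\<in>insert 0 F. (\<Sum>x\<leftarrow>xs. of_real (riesz_product c d n x) * x \<gamma>)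
        = of_nat (length xs) * of_real (riesz_coeff c d n \<gamma>))"
    by (elim exE conjE) (rule that)
  from averaging_characters [OF F'(1)] obtain xs where xs: "xs \<noteq> []" "set xs \<subseteq> dual_group"
    "\<forall>\<gamma>\<in>F'. \<gamma> \<noteq> 0 \<longrightarrow> (\<Sum>x\<leftarrow>xs. x \<gamma>) = 0"
    by (elim exE conjE) (rule that)
  define L where "L = map (\<lambda>x. (riesz_product c d n x / length xs, x)) xs"
  have *: "weighted_sum L f = (\<Sum>x\<leftarrow>xs. of_real (riesz_product c d n x) * f x) / length xs"
    for f :: "('a \<Rightarrow> complex) \<Rightarrow> complex"
  proof -
    have "(\<Sum>x\<leftarrow>ys. (riesz_product c d n x / m) *\<^sub>R f x)
       = (\<Sum>x\<leftarrow>ys. of_real (riesz_product c d n x) * f x) / of_real m" for ys m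
      by (induction ys) (simp_all add: scaleR_conv_of_real add_divide_distrib)
    from this [of "real (length xs)" xs] show ?thesis by (simp add: weighted_sum_def L_def o_def)
  qed
  have L: "weighted_sum L (\<lambda>x. x \<gamma>) = complex_of_real (riesz_coeff c d n \<gamma>)" if "\<gamma> \<in> insert 0 F" for \<gamma>
  proof -
    have "(\<Sum>x\<leftarrow>xs. of_real (riesz_product c d n x) * x \<gamma>)
        = of_nat (length xs) * of_real (riesz_coeff c d n \<gamma>)"
      using F'(2) xs(2,3) that by blast
    then show ?thesis using xs(1) * by simp
  qed
  have Ld: "snd ` set L \<subseteq> dual_group" using xs(2) by (auto simp: L_def)
  have "complex_of_real (weighted_sum M (\<lambda>_. 1)) = weighted_sum M (\<lambda>x. x 0)"
    if "snd ` set M \<subseteq> dual_group" for M :: "(real \<times> ('a \<Rightarrow> complex)) list"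
    using that by (induction M) (auto simp: weighted_sum_def scaleR_conv_of_real dual_group_zero)
  from this [OF Ld] have "weighted_sum L (\<lambda>_. 1::real) = 1"
    using L [of 0] riesz_coeff_at_zero [OF assms(2)] by simp
  moreover have "0 \<le> riesz_product c d n x" if "x \<in> dual_group" for x
    unfolding riesz_product_def
  proof (rule prod_nonneg)
    fix j assume "j \<in> {..<n}"
    have "\<bar>c j * Re (x (d j))\<bar> \<le> 1 * 1" unfolding abs_mult
      using assms(3) abs_Re_le_cmod [of "x (d j)"] dual_group_norm [OF that] by (intro mult_mono) auto
    then show "0 \<le> 1 + c j * Re (x (d j))" by linarith
  qed
  then have "\<forall>(w, x)\<in>set L. 0 \<le> w" using xs(2) by (auto simp: L_def)
  ultimately show thesis using that [of L] L Ld by (auto simp: finite_prob_def)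
qed

subsection \<open>Discrete measures do not interpolate\<close>

lemma sets_positive_variation [simp]: "sets (positive_variation M \<nu>) = sets M"
  by (simp add: positive_variation_def)

text \<open>If the supremum is not a measure, \<open>measure_of\<close> yields the zero measure;
  otherwise it yields the supremum itself. The bound holds in both cases, by monotonicity of
  \<open>N\<close>.\<close>

lemma positive_variation_le:
  assumes N: "sets N = sets M" and le: "\<And>B. B \<in> sets M \<Longrightarrow> ennreal (\<nu> B) \<le> emeasure N B"
  shows "positive_variation M \<nu> \<le> N"
proof (subst le_measure)
  have "(SUP B \<in> {B \<in> sets M. B \<subseteq> A}. ennreal (\<nu> B)) \<le> emeasure N A" if "A \<in> sets M" for A
  proof (rule SUP_least)
    fix B assume "B \<in> {B \<in> sets M. B \<subseteq> A}"
    then show "ennreal (\<nu> B) \<le> emeasure N A"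
      using le [of B] emeasure_mono [of B A N] N that by (auto intro: order_trans)
  qed
  then show "\<forall>A\<in>sets (positive_variation M \<nu>). emeasure (positive_variation M \<nu>) A \<le> emeasure N A"
    by (simp add: positive_variation_def emeasure_measure_of_conv sets.space_closed)
qed (use N in simp)

lemma integral_diff_le_dominating:
  fixes f g :: "'b \<Rightarrow> complex"
  assumes N: "sets N = sets M" "M \<le> N" "finite_measure N"
    and f: "f \<in> borel_measurable M" "\<And>x. x \<in> space M \<Longrightarrow> cmod (f x) \<le> C"
    and g: "g \<in> borel_measurable M" "\<And>x. x \<in> space M \<Longrightarrow> cmod (g x) \<le> C"
  shows "cmod ((LINT x|M. f x) - (LINT x|M. g x)) \<le> (LINT x|N. cmod (f x - g x))"
proof -
  interpret N: finite_measure N by fact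
  have sp: "space N = space M" using N(1) by (rule sets_eq_imp_space_eq)
  have "emeasure M (space M) \<le> emeasure N (space M)" using N by (intro le_measureD3) auto
  then have "emeasure M (space M) \<noteq> \<infinity>"
    using N.emeasure_finite [of "space M"] by (auto simp: top_unique)
  then interpret M: finite_measure M by (rule finite_measureI)
  have int: "integrable M f" "integrable M g"
    using f g by (auto intro!: M.integrable_const_bound [of _ C])
  have [measurable]: "f \<in> borel_measurable M" "g \<in> borel_measurable M" using f g by auto
  have [measurable]: "f \<in> borel_measurable N" "g \<in> borel_measurable N"
    using f(1) g(1) measurable_cong_sets [OF N(1) refl, of borel] by blast+
  have intN: "integrable N (\<lambda>x. cmod (f x - g x))"
  proof (rule N.integrable_const_bound [of _ "C + C"])
    have "cmod (f x - g x) \<le> C + C" if "x \<in> space N" for x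
      using f(2) [of x] g(2) [of x] norm_triangle_ineq4 [of "f x" "g x"] that sp by simp
    then show "AE x in N. norm (cmod (f x - g x)) \<le> C + C" by auto
  qed simp
  have intM: "integrable M (\<lambda>x. cmod (f x - g x))" using int by simp
  have "ennreal (LINT x|M. cmod (f x - g x)) = (\<integral>\<^sup>+x. cmod (f x - g x) \<partial>M)"
    using intM by (simp add: nn_integral_eq_integral)
  also have "\<dots> \<le> (\<integral>\<^sup>+x. cmod (f x - g x) \<partial>N)"
    using N by (intro nn_integral_mono_measure) auto
  also have "\<dots> = ennreal (LINT x|N. cmod (f x - g x))"
    using intN by (simp add: nn_integral_eq_integral)
  finally have "(LINT x|M. cmod (f x - g x)) \<le> (LINT x|N. cmod (f x - g x))"
    by (subst (asm) ennreal_le_iff) auto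
  moreover have "cmod ((LINT x|M. f x) - (LINT x|M. g x)) \<le> (LINT x|M. cmod (f x - g x))"
    using integral_norm_bound [of M "\<lambda>x. f x - g x"] int by simp
  ultimately show ?thesis by linarith
qed

text \<open>The factor 4 counts the positive and negative variations of the real and imaginary
  parts, each dominated by \<open>N\<close>.\<close>

lemma complex_measure_integral_diff_le:
  fixes f g :: "'b \<Rightarrow> complex"
  assumes N: "sets N = sets M" "finite_measure N"
    and le: "\<And>B. B \<in> sets M \<Longrightarrow> ennreal (cmod (\<mu> B)) \<le> emeasure N B"
    and f: "f \<in> borel_measurable M" "\<And>x. x \<in> space M \<Longrightarrow> cmod (f x) \<le> C"
    and g: "g \<in> borel_measurable M" "\<And>x. x \<in> space M \<Longrightarrow> cmod (g x) \<le> C"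
  shows "cmod (complex_measure_integral M \<mu> f - complex_measure_integral M \<mu> g)
    \<le> 4 * (LINT x|N. cmod (f x - g x))"
proof -
  have sp: "space (positive_variation M \<nu>) = space M" for \<nu>
    by (rule sets_eq_imp_space_eq) simp
  have meas: "f \<in> borel_measurable (positive_variation M \<nu>)" "g \<in> borel_measurable (positive_variation M \<nu>)" for \<nu>
    using f(1) g(1) measurable_cong_sets [OF sets_positive_variation refl] by blast+
  have part: "cmod ((LINT x|positive_variation M \<nu>. f x) - (LINT x|positive_variation M \<nu>. g x))
      \<le> (LINT x|N. cmod (f x - g x))" if "\<And>B. \<nu> B \<le> cmod (\<mu> B)" for \<nu>
  proof (rule integral_diff_le_dominating)
    show "positive_variation M \<nu> \<le> N"
      using that le by (intro positive_variation_le N) (meson ennreal_leI order_trans)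
  qed (use meas f g N sp in auto)
  have "cmod (signed_integral M \<nu> f - signed_integral M \<nu> g) \<le> 2 * (LINT x|N. cmod (f x - g x))"
    if "\<And>B. \<bar>\<nu> B\<bar> \<le> cmod (\<mu> B)" for \<nu>
  proof -
    have *: "\<nu> B \<le> cmod (\<mu> B)" "- \<nu> B \<le> cmod (\<mu> B)" for B using that [of B] by auto
    have "signed_integral M \<nu> f - signed_integral M \<nu> g =
      ((LINT x|positive_variation M \<nu>. f x) - (LINT x|positive_variation M \<nu>. g x)) -
      ((LINT x|positive_variation M (\<lambda>A. - \<nu> A). f x) - (LINT x|positive_variation M (\<lambda>A. - \<nu> A). g x))"
      by (simp add: signed_integral_def)
    then show ?thesis
      using part [OF *(1)] part [OF *(2)] norm_triangle_ineq4 by (smt (verit))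
  qed
  from this [of "\<lambda>A. Re (\<mu> A)"] this [of "\<lambda>A. Im (\<mu> A)"] abs_Re_le_cmod abs_Im_le_cmod
  have "cmod (signed_integral M (\<lambda>A. Re (\<mu> A)) f - signed_integral M (\<lambda>A. Re (\<mu> A)) g)
      + cmod (signed_integral M (\<lambda>A. Im (\<mu> A)) f - signed_integral M (\<lambda>A. Im (\<mu> A)) g)
    \<le> 4 * (LINT x|N. cmod (f x - g x))" by fastforce
  moreover have "complex_measure_integral M \<mu> f - complex_measure_integral M \<mu> g
    = (signed_integral M (\<lambda>A. Re (\<mu> A)) f - signed_integral M (\<lambda>A. Re (\<mu> A)) g)
      + \<i> * (signed_integral M (\<lambda>A. Im (\<mu> A)) f - signed_integral M (\<lambda>A. Im (\<mu> A)) g)"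
    by (simp add: complex_measure_integral_def algebra_simps)
  ultimately show ?thesis
    by (metis (no_types, lifting) norm_ii norm_mult mult_1 norm_triangle_ineq order_trans)
qed

section \<open>Fourier transforms of discrete measures\<close>

lemma measurable_evaluation [measurable]: "(\<lambda>x. x \<gamma>) \<in> borel_measurable dual_borel"
  unfolding dual_borel_def
  by (intro measurable_restrict_space1 borel_measurable_continuous_onI continuous_on_product_coordinates)

lemma measurable_cnj_evaluation [measurable]: "(\<lambda>x. cnj (x \<gamma>)) \<in> borel_measurable dual_borel"
  by (intro borel_measurable_continuous_on [OF _ measurable_evaluation] continuous_intros)

lemma space_dual_borel [simp]: "space dual_borel = dual_group"
  by (simp add: dual_borel_def space_restrict_space)

lemma fourier_transform_discrete_diff_le:
  fixes \<gamma> \<delta> :: "'a::ab_group_add"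
  assumes x: "range x \<subseteq> dual_group" and a: "summable (\<lambda>k. cmod (a k))"
    and \<mu>: "\<And>A. A \<in> sets dual_borel \<Longrightarrow> \<mu> A = (\<Sum>k. a k * indicator A (x k))"
  shows "cmod (fourier_transform \<mu> \<gamma> - fourier_transform \<mu> \<delta>)
    \<le> 4 * (\<Sum>k. cmod (a k) * cmod (x k \<gamma> - x k \<delta>))"
proof -
  \<comment> \<open>\<open>N\<close> is the sum of the point masses \<open>cmod (a k)\<close> at
    \<open>x k\<close>, realised as an image of a weighted counting measure; it dominates
    \<open>\<mu>\<close> even if points repeat.\<close>
  define L where "L = density (count_space UNIV) (\<lambda>k. ennreal (cmod (a k)))"
  define N where "N = distr L dual_borel x"
  have [measurable]: "x \<in> measurable L dual_borel"
    using x by (auto simp: L_def)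
  have nn: "(\<integral>\<^sup>+y. ennreal (h y) \<partial>N) = ennreal (\<Sum>k. cmod (a k) * h (x k))"
    and sm: "summable (\<lambda>k. cmod (a k) * h (x k))"
    if h: "h \<in> borel_measurable dual_borel" "\<And>y. 0 \<le> h y" "\<And>y. y \<in> dual_group \<Longrightarrow> h y \<le> C" for h C
  proof -
    show sm: "summable (\<lambda>k. cmod (a k) * h (x k))"
    proof (rule summable_comparison_test')
      show "summable (\<lambda>k. cmod (a k) * C)" using a by (rule summable_mult2)
      show "norm (cmod (a k) * h (x k)) \<le> cmod (a k) * C" if "k \<ge> 0" for k
        using h(2,3) [of "x k"] x by (auto intro!: mult_left_mono simp: abs_mult)
    qed
    have "(\<integral>\<^sup>+y. ennreal (h y) \<partial>N) = (\<Sum>k. ennreal (cmod (a k)) * ennreal (h (x k)))"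
      using h(1) by (simp add: N_def nn_integral_distr) (simp add: L_def nn_integral_density nn_integral_count_space_nat)
    also have "\<dots> = ennreal (\<Sum>k. cmod (a k) * h (x k))"
      using sm h(2) by (simp add: ennreal_mult [symmetric] suminf_ennreal2)
    finally show "(\<integral>\<^sup>+y. ennreal (h y) \<partial>N) = ennreal (\<Sum>k. cmod (a k) * h (x k))" .
  qed
  have emN: "emeasure N A = ennreal (\<Sum>k. cmod (a k) * indicator A (x k))"
    and smA: "summable (\<lambda>k. cmod (a k) * indicator A (x k))" if A: "A \<in> sets dual_borel" for A
  proof -
    have [measurable]: "indicat_real A \<in> borel_measurable dual_borel" using A by simp
    have "emeasure N A = (\<integral>\<^sup>+y. ennreal (indicator A y) \<partial>N)"
      using A by (simp add: N_def ennreal_indicator)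
    then show "emeasure N A = ennreal (\<Sum>k. cmod (a k) * indicator A (x k))"
      using nn [of "indicator A" 1] by (simp add: indicator_def)
    show "summable (\<lambda>k. cmod (a k) * indicator A (x k))"
      using sm [of "indicator A" 1] by (simp add: indicator_def)
  qed
  have fin: "finite_measure N"
    using emN [of dual_group] sets.top [of "dual_borel :: ('a \<Rightarrow> complex) measure"]
    by (intro finite_measureI) (simp add: N_def)
  have bound: "ennreal (cmod (\<mu> B)) \<le> emeasure N B" if B: "B \<in> sets dual_borel" for B
  proof -
    have eq: "cmod (a k * indicator B (x k)) = cmod (a k) * indicator B (x k)" for k
      by (simp add: indicator_def)
    have "cmod (\<Sum>k. a k * indicator B (x k)) \<le> (\<Sum>k. cmod (a k * indicator B (x k)))"
      using smA [OF B] by (intro summable_norm) (simp add: eq)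
    also have "\<dots> = (\<Sum>k. cmod (a k) * indicator B (x k))"
      by (simp add: eq)
    finally show ?thesis using \<mu> [OF B] emN [OF B] by (simp add: ennreal_leI)
  qed
  have "cmod (fourier_transform \<mu> \<gamma> - fourier_transform \<mu> \<delta>)
    \<le> 4 * (LINT y|N. cmod (cnj (y \<gamma>) - cnj (y \<delta>)))"
    unfolding fourier_transform_def
    by (rule complex_measure_integral_diff_le [OF _ fin bound, where C = 1])
      (simp_all add: N_def dual_group_norm)
  also have "(LINT y|N. cmod (cnj (y \<gamma>) - cnj (y \<delta>))) = (LINT y|N. cmod (y \<gamma> - y \<delta>))"
    by (metis complex_cnj_diff complex_mod_cnj)
  also have "\<dots> = (\<Sum>k. cmod (a k) * cmod (x k \<gamma> - x k \<delta>))"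
  proof -
    have le2: "cmod (y \<gamma> - y \<delta>) \<le> 2" if "y \<in> dual_group" for y
      using norm_triangle_ineq4 [of "y \<gamma>" "y \<delta>"] dual_group_norm [OF that] by simp
    have "(LINT y|N. cmod (y \<gamma> - y \<delta>)) = enn2real (\<integral>\<^sup>+y. cmod (y \<gamma> - y \<delta>) \<partial>N)"
      by (rule integral_eq_nn_integral) (simp_all add: N_def)
    also have "\<dots> = (\<Sum>k. cmod (a k) * cmod (x k \<gamma> - x k \<delta>))"
      using nn [of "\<lambda>y. cmod (y \<gamma> - y \<delta>)" 2] sm [of "\<lambda>y. cmod (y \<gamma> - y \<delta>)" 2] le2
      by (simp add: suminf_nonneg)
    finally show ?thesis .
  qed
  finally show ?thesis .
qed

text \<open>Bolzano-Weierstrass in the unit disc, applied to one \<open>j\<close> after another; two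
  terms far out in the resulting subsequence are close for all \<open>j < n\<close>.\<close>

lemma finite_characters_close:
  fixes x :: "nat \<Rightarrow> 'a \<Rightarrow> complex" and c :: "nat \<Rightarrow> 'a"
  assumes "\<And>j i. cmod (x j (c i)) \<le> 1" "0 < \<epsilon>"
  obtains i k where "i < k" "\<And>j. j < n \<Longrightarrow> cmod (x j (c i) - x j (c k)) < \<epsilon>"
proof -
  have "\<exists>s :: nat \<Rightarrow> nat. strict_mono s \<and> (\<forall>j<n. convergent (\<lambda>i. x j (c (s i))))"
  proof (induction n)
    case 0
    show ?case by (auto intro!: exI [of _ id] strict_mono_id)
  next
    case (Suc n)
    then obtain s :: "nat \<Rightarrow> nat" where s: "strict_mono s" "\<forall>j<n. convergent (\<lambda>i. x j (c (s i)))"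
      by (elim exE conjE) (rule that)
    have "compact (cball (0::complex) 1)" by simp
    then obtain l r where r: "strict_mono (r :: nat \<Rightarrow> nat)" "((\<lambda>i. x n (c (s i))) \<circ> r) \<longlonglongrightarrow> l"
      using assms(1) unfolding compact_def by (metis mem_cball_0)
    have "convergent (\<lambda>i. x j (c (s (r i))))" if "j < Suc n" for j
    proof (cases "j = n")
      case True
      then show ?thesis using r(2) by (auto simp: convergent_def o_def)
    next
      case False
      then have "convergent ((\<lambda>i. x j (c (s i))) \<circ> r)"
        using s(2) that r(1) by (intro convergent_subseq_convergent) auto
      then show ?thesis by (simp add: o_def)
    qed
    then show ?case using strict_mono_o [OF s(1) r(1)] by (intro exI [of _ "s \<circ> r"]) (simp add: o_def)
  qed
  then obtain s :: "nat \<Rightarrow> nat" where s: "strict_mono s" "\<forall>j<n. convergent (\<lambda>i. x j (c (s i)))"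
    by (elim exE conjE) (rule that)
  have "\<exists>M. \<forall>p\<ge>M. \<forall>q\<ge>M. cmod (x j (c (s p)) - x j (c (s q))) < \<epsilon>" if "j < n" for j
    using s(2) that assms(2) by (intro CauchyD convergent_Cauchy) auto
  then obtain M where M: "\<And>j p q. j < n \<Longrightarrow> M j \<le> p \<Longrightarrow> M j \<le> q \<Longrightarrow> cmod (x j (c (s p)) - x j (c (s q))) < \<epsilon>"
    by metis
  define p where "p = Max (insert 0 (M ` {..<n}))"
  have "M j \<le> p" if "j < n" for j using that by (auto simp: p_def intro!: Max_ge)
  then show thesis
    using that [of "s p" "s (Suc p)"] M s(1) by (simp add: strict_mono_Suc_iff le_SucI)
qed

lemma not_I0_set:
  fixes c d r :: "nat \<Rightarrow> 'a::ab_group_add"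
  assumes r: "\<And>i j. i < j \<Longrightarrow> \<exists>k. r k = c i - c j"
    and disj: "\<And>k l. d k + r k \<noteq> d l"
  shows "\<not> I0_set (range d \<union> range (\<lambda>k. d k + r k))"
proof
  define \<phi> where "\<phi> = (\<lambda>\<gamma>. of_bool (\<gamma> \<in> range d) :: complex)"
  assume "I0_set (range d \<union> range (\<lambda>k. d k + r k))"
  moreover have "bounded (\<phi> ` S)" for S
    by (rule boundedI [of _ 1]) (auto simp: \<phi>_def)
  ultimately obtain \<mu> where \<mu>: "discrete_dual_measure \<mu>"
    "\<And>\<gamma>. \<gamma> \<in> range d \<union> range (\<lambda>k. d k + r k) \<Longrightarrow> fourier_transform \<mu> \<gamma> = \<phi> \<gamma>"
    unfolding I0_set_def by metis
  then obtain a x where x: "range x \<subseteq> dual_group" and a: "summable (\<lambda>k. cmod (a k))"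
    and eq: "\<And>A. A \<in> sets dual_borel \<Longrightarrow> \<mu> A = (\<Sum>k. a k * indicator A (x k))"
    unfolding discrete_dual_measure_def by metis
  have xd: "x j \<in> dual_group" for j using x by auto
  have "1 \<le> 4 * (\<Sum>j. cmod (a j) * cmod (1 - x j (r k)))" for k
  proof -
    have "fourier_transform \<mu> (d k) = 1" using \<mu>(2) [of "d k"] by (simp add: \<phi>_def)
    moreover have "fourier_transform \<mu> (d k + r k) = 0"
    proof -
      have "d k + r k \<notin> range d" using disj by auto
      then show ?thesis using \<mu>(2) [of "d k + r k"] by (simp add: \<phi>_def)
    qed
    ultimately have "1 \<le> 4 * (\<Sum>j. cmod (a j) * (\<lambda>j. cmod (x j (d k) - x j (d k + r k))) j)"
      using fourier_transform_discrete_diff_le [OF x a eq, of "d k" "d k + r k"] by simp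
    \<comment> \<open>A character changes between \<open>d k\<close> and \<open>d k + r k\<close> by
      an amount that depends on \<open>r k\<close> alone; this lets \<open>k\<close> be chosen
      through \<open>r k\<close>.\<close>
    also have "(\<lambda>j. cmod (x j (d k) - x j (d k + r k))) = (\<lambda>j. cmod (1 - x j (r k)))"
    proof
      fix j
      have "x j (d k) - x j (d k + r k) = x j (d k) * (1 - x j (r k))"
        using xd by (simp add: dual_group_add algebra_simps)
      then show "cmod (x j (d k) - x j (d k + r k)) = cmod (1 - x j (r k))"
        using dual_group_norm [OF xd] by (simp add: norm_mult)
    qed
    finally show ?thesis .
  qed
  moreover obtain k where "(\<Sum>j. cmod (a j) * cmod (1 - x j (r k))) < 1 / 4"
  proof -
    define A where "A = (\<Sum>j. cmod (a j))"
    have A: "0 \<le> A" using a by (simp add: A_def suminf_nonneg)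
    obtain n where "\<forall>m\<ge>n. norm (\<Sum>j. cmod (a (j + m))) < 1 / 16"
      using suminf_exist_split [of "1/16" "\<lambda>j. cmod (a j)"] a by auto
    then have n: "(\<Sum>j. cmod (a (j + n))) < 1 / 16" by force
    \<comment> \<open>The tail contributes less than 2/16 and the first \<open>n\<close> terms at
      most 1/16, in total less than 1/4. The summand 1 guards against \<open>A = 0\<close>.\<close>
    define \<epsilon> where "\<epsilon> = 1 / (16 * (A + 1))"
    have \<epsilon>: "0 < \<epsilon>" "A * \<epsilon> \<le> 1 / 16" using A by (auto simp: \<epsilon>_def field_simps)
    have "cmod (x j (c i)) \<le> 1" for i j using dual_group_norm [OF xd] by simp
    from finite_characters_close [of x c, OF this \<epsilon>(1)]
    obtain i l where il: "i < l" "\<And>j. j < n \<Longrightarrow> cmod (x j (c i) - x j (c l)) < \<epsilon>" by metis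
    obtain k where k: "r k = c i - c l" using r [OF il(1)] by metis
    have close: "cmod (1 - x j (r k)) = cmod (x j (c i) - x j (c l))" for j
    proof -
      have "x j (c i) = x j (c i - c l) * x j (c l)"
        using dual_group_add [OF xd, of j "c i - c l" "c l"] by simp
      then have "x j (c i) - x j (c l) = - ((1 - x j (r k)) * x j (c l))"
        by (simp add: k algebra_simps)
      then show ?thesis using dual_group_norm [OF xd] by (simp add: norm_mult)
    qed
    have le2: "cmod (1 - x j (r k)) \<le> 2" for j
      using norm_triangle_ineq4 [of 1 "x j (r k)"] dual_group_norm [OF xd] by simp
    have sm: "summable (\<lambda>j. cmod (a j) * cmod (1 - x j (r k)))"
    proof (rule summable_comparison_test')
      show "summable (\<lambda>j. cmod (a j) * 2)" using a by (rule summable_mult2)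
      show "norm (cmod (a j) * cmod (1 - x j (r k))) \<le> cmod (a j) * 2" if "j \<ge> 0" for j
        using le2 by (simp add: mult_left_mono)
    qed
    have "(\<Sum>j. cmod (a j) * cmod (1 - x j (r k)))
      = (\<Sum>j. cmod (a (j + n)) * cmod (1 - x (j + n) (r k))) + (\<Sum>j<n. cmod (a j) * cmod (1 - x j (r k)))"
      using sm by (rule suminf_split_initial_segment)
    also have "(\<Sum>j. cmod (a (j + n)) * cmod (1 - x (j + n) (r k))) \<le> (\<Sum>j. cmod (a (j + n)) * 2)"
      using sm a le2 by (intro suminf_le summable_mult2 mult_left_mono)
        (use summable_ignore_initial_segment [OF a, of n] summable_ignore_initial_segment [OF sm, of n] in simp_all)
    also have "\<dots> = (\<Sum>j. cmod (a (j + n))) * 2"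
      using a by (intro suminf_mult2 [symmetric]) (rule summable_ignore_initial_segment)
    also have "(\<Sum>j<n. cmod (a j) * cmod (1 - x j (r k))) \<le> (\<Sum>j<n. cmod (a j) * \<epsilon>)"
      using il(2) by (intro sum_mono mult_left_mono) (auto simp: close less_imp_le)
    also have "\<dots> \<le> A * \<epsilon>"
      unfolding sum_distrib_right [symmetric] A_def using a \<epsilon>(1)
      by (intro mult_right_mono sum_le_suminf) auto
    finally have "(\<Sum>j. cmod (a j) * cmod (1 - x j (r k))) < 1 / 4" using n \<epsilon>(2) by simp
    then show thesis by (rule that)
  qed
  ultimately show False by (metis less_divide_eq_numeral1(1) mult.commute not_less)
qed

subsection \<open>Weak limits on the line\<close>

text \<open>A continuous function on the line that is 0 up to 1/3 and 1 from 2/3 on. On the Cantor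
  set it reads half of the first ternary digit, and \<open>ternary_shift\<close> deletes that
  digit.\<close>

definition ternary_digit :: "real \<Rightarrow> real" where
  "ternary_digit t = max 0 (min 1 (3 * t - 1))"

definition ternary_shift :: "real \<Rightarrow> real" where
  "ternary_shift t = 3 * t - 2 * ternary_digit t"

lemma ternary_sum:
  fixes b :: "nat \<Rightarrow> bool"
  defines "C \<equiv> (\<lambda>b :: nat \<Rightarrow> bool. \<Sum>n. 2 * of_bool (b n) / 3 ^ Suc n :: real)"
  shows "0 \<le> C b" "C b \<le> 1" "C b = (2 * of_bool (b 0) + C (\<lambda>n. b (Suc n))) / 3"
proof -
  have geo: "(\<lambda>n. (2 / 3) * (1 / 3) ^ n :: real) sums ((2 / 3) * (1 / (1 - 1 / 3)))"
    by (intro sums_mult geometric_sums) simp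
  have sm: "summable (\<lambda>n. 2 * of_bool (b n) / 3 ^ Suc n :: real)" for b :: "nat \<Rightarrow> bool"
    by (rule summable_comparison_test' [OF sums_summable [OF geo]]) (auto simp: power_one_over divide_simps)
  show "0 \<le> C b" unfolding C_def by (intro suminf_nonneg sm) simp
  have "C b \<le> (\<Sum>n. (2 / 3) * (1 / 3) ^ n)"
    unfolding C_def by (intro suminf_le sm sums_summable [OF geo]) (auto simp: power_one_over divide_simps)
  then show "C b \<le> 1" using sums_unique [OF geo] by simp
  have "C b = 2 * of_bool (b 0) / 3 + (\<Sum>n. 2 * of_bool (b (Suc n)) / 3 ^ Suc (Suc n))"
    unfolding C_def using suminf_split_initial_segment [OF sm [of b], of 1] by simp
  also have "(\<Sum>n. 2 * of_bool (b (Suc n)) / 3 ^ Suc (Suc n))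
      = (\<Sum>n. 2 * of_bool (b (Suc n)) / 3 ^ Suc n / 3 :: real)"
    by (simp add: mult.commute)
  also have "\<dots> = C (\<lambda>n. b (Suc n)) / 3"
    unfolding C_def by (rule suminf_divide [OF sm])
  finally show "C b = (2 * of_bool (b 0) + C (\<lambda>n. b (Suc n))) / 3" by simp
qed

lemma ternary_digits_of_sum:
  "\<exists>t\<in>{0..1}. \<forall>n. ternary_digit ((ternary_shift ^^ n) t) = of_bool (b n)"
proof
  define C where "C b = (\<Sum>n. 2 * of_bool (b n) / 3 ^ Suc n :: real)" for b :: "nat \<Rightarrow> bool"
  note C = ternary_sum [folded C_def]
  have digit: "ternary_digit (C b) = of_bool (b 0)" for b
    using C(1,2) [of "\<lambda>n. b (Suc n)"] C(3) [of b] by (auto simp: ternary_digit_def)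
  have shift: "ternary_shift (C b) = C (\<lambda>n. b (Suc n))" for b
    unfolding ternary_shift_def digit using C(3) [of b] by simp
  have "(ternary_shift ^^ n) (C b) = C (\<lambda>k. b (k + n))" for n
    by (induction n) (simp_all add: shift)
  then show "\<forall>n. ternary_digit ((ternary_shift ^^ n) (C b)) = of_bool (b n)"
    by (simp add: digit)
  show "C b \<in> {0..1}" using C(1,2) [of b] by simp
qed

lemma binary_expansion:
  fixes \<theta> :: real
  assumes "0 \<le> \<theta>" "\<theta> < 1"
  shows "(\<lambda>n. of_bool (odd \<lfloor>2 ^ Suc n * \<theta>\<rfloor>) / 2 ^ Suc n) sums \<theta>"
proof -
  have step: "\<lfloor>2 * y\<rfloor> = 2 * \<lfloor>y\<rfloor> + of_bool (odd \<lfloor>2 * y\<rfloor>)" for y :: real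
  proof -
    have "\<lfloor>2 * y\<rfloor> = 2 * \<lfloor>y\<rfloor> \<or> \<lfloor>2 * y\<rfloor> = 2 * \<lfloor>y\<rfloor> + 1" by linarith
    then show ?thesis by auto
  qed
  \<comment> \<open>The first \<open>n\<close> binary digits add up to \<open>\<theta>\<close>
    rounded down to a multiple of \<open>1 / 2 ^ n\<close>.\<close>
  have sum: "(\<Sum>k<n. of_bool (odd \<lfloor>2 ^ Suc k * \<theta>\<rfloor>) / 2 ^ Suc k) = real_of_int \<lfloor>2 ^ n * \<theta>\<rfloor> / 2 ^ n" for n
  proof (induction n)
    case 0
    then show ?case using assms by (simp add: floor_eq_iff)
  next
    case (Suc n)
    have "real_of_int \<lfloor>2 ^ Suc n * \<theta>\<rfloor> = 2 * of_int \<lfloor>2 ^ n * \<theta>\<rfloor> + of_bool (odd \<lfloor>2 ^ Suc n * \<theta>\<rfloor>)"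
      using arg_cong [OF step [of "2 ^ n * \<theta>"], of real_of_int] by (simp add: mult.assoc)
    then have "real_of_int \<lfloor>2 ^ Suc n * \<theta>\<rfloor> / 2 ^ Suc n
        = real_of_int \<lfloor>2 ^ n * \<theta>\<rfloor> / 2 ^ n + of_bool (odd \<lfloor>2 ^ Suc n * \<theta>\<rfloor>) / 2 ^ Suc n"
      by (simp only: add_divide_distrib power_Suc mult_divide_mult_cancel_left)
    then show ?case unfolding sum.lessThan_Suc Suc.IH by (rule sym)
  qed
  have "(\<lambda>n. real_of_int \<lfloor>2 ^ n * \<theta>\<rfloor> / 2 ^ n) \<longlonglongrightarrow> \<theta>"
  proof (rule tendsto_sandwich)
    show "(\<lambda>n. \<theta> - (1 / 2) ^ n) \<longlonglongrightarrow> \<theta>"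
      using tendsto_diff [OF tendsto_const LIMSEQ_power_zero [of "1 / 2 :: real"]] by simp
    have "\<theta> - (1 / 2) ^ n \<le> real_of_int \<lfloor>2 ^ n * \<theta>\<rfloor> / 2 ^ n" for n
    proof -
      have "2 ^ n * \<theta> - 1 \<le> real_of_int \<lfloor>2 ^ n * \<theta>\<rfloor>" by linarith
      then have "(2 ^ n * \<theta> - 1) / 2 ^ n \<le> real_of_int \<lfloor>2 ^ n * \<theta>\<rfloor> / 2 ^ n"
        by (rule divide_right_mono) simp
      then show ?thesis by (simp add: diff_divide_distrib power_one_over)
    qed
    then show "\<forall>\<^sub>F n in sequentially. \<theta> - (1 / 2) ^ n \<le> real_of_int \<lfloor>2 ^ n * \<theta>\<rfloor> / 2 ^ n" by simp
    have "real_of_int \<lfloor>2 ^ n * \<theta>\<rfloor> / 2 ^ n \<le> \<theta>" for n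
      using of_int_floor_le [of "2 ^ n * \<theta>"] by (simp add: field_simps)
    then show "\<forall>\<^sub>F n in sequentially. real_of_int \<lfloor>2 ^ n * \<theta>\<rfloor> / 2 ^ n \<le> \<theta>" by simp
  qed simp
  then show ?thesis unfolding sums_def sum .
qed

text \<open>The classical continuous surjection of the Cantor set onto the Hilbert cube, extended to the line.\<close>

lemma continuous_onto_cube:
  "\<exists>u :: nat \<Rightarrow> real \<Rightarrow> real. (\<forall>i. continuous_on UNIV (u i)) \<and> (\<forall>i t. \<bar>u i t\<bar> \<le> 1) \<and>
    (\<forall>\<theta>. (\<forall>i. 0 \<le> \<theta> i \<and> \<theta> i < 1) \<longrightarrow> (\<exists>t\<in>{0..1}. \<forall>i. u i t = \<theta> i))"
proof (intro exI conjI allI impI)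
  define D where "D n t = ternary_digit ((ternary_shift ^^ n) t)" for n t
  \<comment> \<open>The pairing function splits one digit sequence into countably many: digit
    \<open>prod_encode (i, j)\<close> of \<open>t\<close> is binary digit \<open>j\<close> of
    coordinate \<open>i\<close>.\<close>
  define f where "f i j t = D (prod_encode (i, j)) t / 2 ^ Suc j" for i j t
  let ?u = "\<lambda>i t. \<Sum>j. f i j t"
  have D: "0 \<le> D n t" "D n t \<le> 1" for n t by (auto simp: D_def ternary_digit_def)
  have cont_digit: "continuous_on UNIV ternary_digit"
    unfolding ternary_digit_def by (intro continuous_intros)
  have cont_shift: "continuous_on UNIV (ternary_shift ^^ n)" for n
  proof (induction n)
    case (Suc n)
    have "continuous_on UNIV ternary_shift"
      unfolding ternary_shift_def by (intro continuous_intros cont_digit)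
    then show ?case
      using continuous_on_compose2 [OF \<open>continuous_on UNIV ternary_shift\<close> Suc] by simp
  qed (simp add: id_def)
  have cont_D: "continuous_on UNIV (D n)" for n
    unfolding D_def by (rule continuous_on_compose2 [OF cont_digit cont_shift]) simp
  have cont_f: "continuous_on UNIV (f i j)" for i j
    unfolding f_def by (rule continuous_on_divide [OF cont_D continuous_on_const]) simp
  have geo: "(\<lambda>j. (1 / 2) * (1 / 2) ^ j :: real) sums ((1 / 2) * (1 / (1 - 1 / 2)))"
    by (intro sums_mult geometric_sums) simp
  have f: "0 \<le> f i j t" "f i j t \<le> (1 / 2) * (1 / 2) ^ j" for i j t
    using D by (auto simp: f_def power_one_over divide_simps)
  have sm: "summable (\<lambda>j. f i j t)" for i t
    by (rule summable_comparison_test' [OF sums_summable [OF geo]]) (use f in auto)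
  show "continuous_on UNIV (?u i)" for i
  proof (rule uniform_limit_theorem)
    show "uniform_limit UNIV (\<lambda>n t. \<Sum>j<n. f i j t) (?u i) sequentially"
      by (rule Weierstrass_m_test [OF _ sums_summable [OF geo]]) (use f in auto)
  qed (auto intro!: always_eventually continuous_on_sum cont_f)
  show "\<bar>?u i t\<bar> \<le> 1" for i t
  proof -
    have "?u i t \<le> (\<Sum>j. (1 / 2) * (1 / 2) ^ j)"
      by (intro suminf_le f sm sums_summable [OF geo])
    then show ?thesis using sums_unique [OF geo] suminf_nonneg [OF sm f(1)] by simp
  qed
  fix \<theta> :: "nat \<Rightarrow> real" assume \<theta>: "\<forall>i. 0 \<le> \<theta> i \<and> \<theta> i < 1"
  obtain t where t: "t \<in> {0..1}"
    "\<forall>n. D n t = of_bool (odd \<lfloor>2 ^ Suc (snd (prod_decode n)) * \<theta> (fst (prod_decode n))\<rfloor>)"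
    unfolding D_def
    by (rule bexE [OF ternary_digits_of_sum [of "\<lambda>n. odd \<lfloor>2 ^ Suc (snd (prod_decode n)) * \<theta> (fst (prod_decode n))\<rfloor>"]])
  have "?u i t = \<theta> i" for i
    using binary_expansion [of "\<theta> i"] \<theta> t(2) by (simp add: f_def sums_iff)
  then show "\<exists>t\<in>{0..1}. \<forall>i. ?u i t = \<theta> i" using t(1) by blast
qed

text \<open>The weights sit on list positions rather than on points. Since
  \<open>point_measure\<close> carries all subsets, every \<open>\<psi>\<close> is measurable,
  however irregular.\<close>

lemma finite_prob_as_real_distribution:
  fixes L :: "(real \<times> 'b) list" and \<psi> :: "'b \<Rightarrow> real"
  assumes L: "finite_prob L"
  defines "\<mu> \<equiv> distr (point_measure {..<length L} (\<lambda>i. ennreal (fst (L ! i)))) borel (\<lambda>i. \<psi> (snd (L ! i)))"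
  shows "real_distribution \<mu>"
    and "\<And>f :: real \<Rightarrow> 'c::euclidean_space. f \<in> borel_measurable borel \<Longrightarrow>
      (LINT t|\<mu>. f t) = weighted_sum L (\<lambda>x. f (\<psi> x))"
    and "\<And>S. S \<in> sets borel \<Longrightarrow> \<psi> ` snd ` set L \<subseteq> S \<Longrightarrow> measure \<mu> S = 1"
proof -
  define P where "P = point_measure {..<length L} (\<lambda>i. ennreal (fst (L ! i)))"
  have w: "0 \<le> fst (L ! i)" if "i < length L" for i
    using L that nth_mem [OF that] by (auto simp: finite_prob_def case_prod_beta)
  have ws: "weighted_sum L f = (\<Sum>i<length L. fst (L ! i) *\<^sub>R f (snd (L ! i)))" for f :: "'b \<Rightarrow> 'd::real_vector"
    by (simp add: weighted_sum_def sum_list_sum_nth case_prod_beta lessThan_atLeast0)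
  have "emeasure P (space P) = (\<Sum>i<length L. ennreal (fst (L ! i)))"
    unfolding P_def by (simp add: space_point_measure emeasure_point_measure_finite)
  also have "\<dots> = ennreal (weighted_sum L (\<lambda>_. 1::real))"
    using w by (subst sum_ennreal) (simp_all add: ws)
  finally have "emeasure P (space P) = 1" using L by (simp add: finite_prob_def)
  then interpret P: prob_space P by (rule prob_spaceI)
  have [measurable]: "(\<lambda>i. \<psi> (snd (L ! i))) \<in> borel_measurable P"
    by (simp add: P_def)
  show "real_distribution \<mu>"
    unfolding \<mu>_def P_def [symmetric] by simp
  show "(LINT t|\<mu>. f t) = weighted_sum L (\<lambda>x. f (\<psi> x))" if "f \<in> borel_measurable borel" for f :: "real \<Rightarrow> 'c"
  proof -
    have "(LINT t|\<mu>. f t) = (LINT i|P. f (\<psi> (snd (L ! i))))"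
      unfolding \<mu>_def P_def [symmetric] using that by (intro integral_distr) auto
    also have "\<dots> = weighted_sum L (\<lambda>x. f (\<psi> x))"
      unfolding P_def ws using w by (intro lebesgue_integral_point_measure_finite) auto
    finally show ?thesis .
  qed
  show "measure \<mu> S = 1" if S: "S \<in> sets borel" "\<psi> ` snd ` set L \<subseteq> S" for S
  proof -
    have "\<psi> (snd (L ! i)) \<in> S" if "i < length L" for i
      using S(2) nth_mem [OF that] by blast
    then have "(\<lambda>i. \<psi> (snd (L ! i))) -` S \<inter> space P = space P"
      by (auto simp: P_def space_point_measure)
    then show ?thesis
      unfolding \<mu>_def P_def [symmetric] using S(1) P.prob_space by (simp add: measure_distr)
  qed
qed

lemma weighted_sum_cong:
  assumes "\<And>x. x \<in> snd ` set L \<Longrightarrow> f x = g x"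
  shows "weighted_sum L f = weighted_sum L g"
  unfolding weighted_sum_def by (rule arg_cong [of _ _ sum_list], rule map_cong) (use assms in force)+

lemma weighted_sum_zero [simp]: "weighted_sum L (\<lambda>_. 0) = 0"
  by (induction L) (auto simp: weighted_sum_def)

text \<open>Helly's theorem provides only a subsequence. It is hidden by speaking just of those
  \<open>f\<close> whose weighted sums converge along the full sequence. Since \<open>\<psi>\<close>
  is arbitrary, the limit is located only in the closure of the image.\<close>

lemma finite_prob_weak_limit:
  fixes L :: "nat \<Rightarrow> (real \<times> 'b) list" and \<psi> :: "'b \<Rightarrow> real"
  assumes L: "\<And>n. finite_prob (L n)" "\<And>n. snd ` set (L n) \<subseteq> G" and \<psi>: "\<psi> ` G \<subseteq> {0..1}"
  shows "\<exists>M. real_distribution M \<and> (AE t in M. t \<in> closure (\<psi> ` G)) \<and>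
    (\<forall>(f :: real \<Rightarrow> complex) B l. continuous_on UNIV f \<longrightarrow> (\<forall>t. cmod (f t) \<le> B) \<longrightarrow>
      (\<lambda>n. weighted_sum (L n) (\<lambda>x. f (\<psi> x))) \<longlonglongrightarrow> l \<longrightarrow> (LINT t|M. f t) = l)"
proof -
  define \<mu> where "\<mu> n = distr (point_measure {..<length (L n)} (\<lambda>i. ennreal (fst (L n ! i)))) borel
    (\<lambda>i. \<psi> (snd (L n ! i)))" for n
  note \<mu> = finite_prob_as_real_distribution [OF L(1), where \<psi> = \<psi>, folded \<mu>_def]
  have "tight \<mu>"
    unfolding tight_def
  proof (intro conjI allI impI)
    fix \<epsilon> :: real assume "0 < \<epsilon>"
    have "\<psi> ` snd ` set (L n) \<subseteq> {-1<..1}" for n using \<psi> L(2) [of n] by force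
    then have "measure (\<mu> n) {-1<..1} = 1" for n by (intro \<mu>) simp_all
    then show "\<exists>a b. a < b \<and> (\<forall>n. 1 - \<epsilon> < measure (\<mu> n) {a<..b})"
      using \<open>0 < \<epsilon>\<close> by (intro exI [of _ "-1"] exI [of _ 1]) simp
  qed (rule \<mu>)
  from tight_imp_convergent_subsubsequence [OF this strict_mono_id]
  obtain r M where r: "strict_mono r" and M: "real_distribution M" and conv: "weak_conv_m (\<mu> \<circ> id \<circ> r) M"
    by (elim exE conjE) (rule that)
  interpret M: real_distribution M by (rule M)
  have lim: "(\<lambda>n. weighted_sum (L (r n)) (\<lambda>x. f (\<psi> x))) \<longlonglongrightarrow> (LINT t|M. f t)"
    if "continuous_on UNIV f" "\<And>t. norm (f t) \<le> B" for f :: "real \<Rightarrow> 'c::euclidean_space" and B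
  proof -
    have "(\<lambda>n. LINT t|(\<mu> \<circ> id \<circ> r) n. f t) \<longlonglongrightarrow> (LINT t|M. f t)"
      using that \<mu>(1) M conv
      by (intro weak_conv_imp_integral_bdd_continuous_conv [of _ M f B])
        (auto simp: continuous_on_eq_continuous_at o_def)
    then show ?thesis using that(1) by (simp add: \<mu>(2) borel_measurable_continuous_onI)
  qed
  show ?thesis
  proof (intro exI [of _ M] conjI allI impI)
    show "AE t in M. t \<in> closure (\<psi> ` G)"
    proof -
      define K where "K = closure (\<psi> ` G)"
      \<comment> \<open>A bounded continuous function with zero set \<open>K\<close>. Its weighted
        sums are all 0, so its integral against the limit is 0.\<close>
      let ?f = "\<lambda>t. min 1 (infdist t K)"
      have G: "G \<noteq> {}" using L [of 0] by (auto simp: finite_prob_def weighted_sum_def)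
      have cont: "continuous_on UNIV ?f" by (intro continuous_intros)
      have nonneg: "0 \<le> ?f t" for t by (simp add: infdist_nonneg)
      have bdd: "norm (?f t) \<le> 1" for t
        unfolding real_norm_def abs_of_nonneg [OF nonneg] by (rule min.cobounded1)
      have "?f (\<psi> x) = 0" if "x \<in> G" for x
      proof -
        have "\<psi> x \<in> K" unfolding K_def using that by (intro subsetD [OF closure_subset] imageI)
        then have "infdist (\<psi> x) K = 0" by (rule infdist_zero)
        then show ?thesis by simp
      qed
      then have "weighted_sum (L n) (\<lambda>x. ?f (\<psi> x)) = 0" for n
        using L(2) [of n] by (subst weighted_sum_cong [of _ _ "\<lambda>_. 0"]) auto
      then have int: "(LINT t|M. ?f t) = 0"
        using lim [OF cont bdd] by (simp add: LIMSEQ_const_iff)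
      have "?f \<in> borel_measurable borel" by (rule borel_measurable_continuous_onI [OF cont])
      then have "integrable M ?f"
        using bdd by (intro M.integrable_const_bound [of _ 1]) auto
      then have "AE t in M. ?f t = 0"
        using int nonneg by (subst (asm) integral_nonneg_eq_0_iff_AE) auto
      moreover have "t \<in> K" if "?f t = 0" for t
      proof -
        have "infdist t K = 0" using that by linarith
        moreover have "closed K" "K \<noteq> {}" using G by (simp_all add: K_def)
        ultimately show ?thesis using in_closed_iff_infdist_zero by blast
      qed
      ultimately have "AE t in M. t \<in> K" by (rule eventually_mono)
      then show ?thesis unfolding K_def .
    qed
    fix f :: "real \<Rightarrow> complex" and B l
    assume "continuous_on UNIV f" "\<forall>t. cmod (f t) \<le> B" "(\<lambda>n. weighted_sum (L n) (\<lambda>x. f (\<psi> x))) \<longlonglongrightarrow> l"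
    then show "(LINT t|M. f t) = l"
      using lim [of f B] LIMSEQ_subseq_LIMSEQ [OF _ r] by (auto simp: o_def intro: LIMSEQ_unique)
  qed (rule M)
qed

subsection \<open>Regular measures on the dual group\<close>

text \<open>The functions \<open>u i\<close> are logarithms of the values of a character at \<open>h i\<close>, in terms of a real
  parameter. Divisibility of the space of bounded continuous functions provides, coherently, logarithms
  at all other elements of the group.\<close>

lemma continuous_character_family:
  fixes h :: "nat \<Rightarrow> 'a::ab_group_add" and u :: "nat \<Rightarrow> real \<Rightarrow> real" and \<psi> :: "('a \<Rightarrow> complex) \<Rightarrow> real"
  assumes u: "\<And>i. continuous_on UNIV (u i)" "\<And>i t. \<bar>u i t\<bar> \<le> 1"
    and \<psi>: "\<And>x i. x \<in> dual_group \<Longrightarrow> cis (2 * pi * u i (\<psi> x)) = x (h i)"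
  shows "\<exists>f. continuous_on UNIV f \<and> (\<forall>t\<in>closure (\<psi> ` dual_group). f t \<in> dual_group \<and>
    (\<forall>i. f t (h i) = cis (2 * pi * u i t)))"
proof -
  \<comment> \<open>Pairs of a group element and a continuous logarithm, along
    \<open>\<psi>\<close>, of the values at that element. Boundedness by 1 puts each
    \<open>u i\<close> into the real vector space to which divisibility applies.\<close>
  define P0 :: "('a \<times> (real \<Rightarrow>\<^sub>C real)) set" where
    "P0 = {(\<gamma>, v). \<forall>x\<in>dual_group. cis (2 * pi * apply_bcontfun v (\<psi> x)) = x \<gamma>}"
  have "add_subgroup P0"
    unfolding add_subgroup_def
  proof (intro conjI ballI)
    show "0 \<in> P0" by (simp add: P0_def zero_prod_def dual_group_zero)
    fix p q assume "p \<in> P0" "q \<in> P0"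
    then obtain \<gamma> v \<delta> w where pq: "p = (\<gamma>, v)" "q = (\<delta>, w)"
      "\<forall>x\<in>dual_group. cis (2 * pi * apply_bcontfun v (\<psi> x)) = x \<gamma>"
      "\<forall>x\<in>dual_group. cis (2 * pi * apply_bcontfun w (\<psi> x)) = x \<delta>"
      by (auto simp: P0_def)
    have "cis (2 * pi * (a - b)) = cis (2 * pi * a) * cnj (cis (2 * pi * b))" for a b
      by (simp add: cis_cnj cis_mult algebra_simps)
    then show "p - q \<in> P0" using pq by (simp add: P0_def dual_group_diff)
  qed
  then obtain P where P: "add_subgroup P" "P0 \<subseteq> P" "fst ` P = UNIV"
    "\<And>v. (0, v) \<in> P \<Longrightarrow> (0, v) \<in> P0" by (rule divisible_extension) (erule that; blast)
  define V where "V \<gamma> = (SOME v. (\<gamma>, v) \<in> P)" for \<gamma>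
  have V: "(\<gamma>, V \<gamma>) \<in> P" for \<gamma>
  proof -
    have "\<gamma> \<in> fst ` P" using P(3) by simp
    then have "\<exists>v. (\<gamma>, v) \<in> P" by (metis imageE prod.collapse)
    then show ?thesis unfolding V_def by (rule someI_ex)
  qed
  define f where "f t \<gamma> = cis (2 * pi * apply_bcontfun (V \<gamma>) t)" for t \<gamma>
  \<comment> \<open>Being a logarithm of 1 passes from the image of \<open>\<psi>\<close> to its
    closure by continuity. This makes \<open>f t\<close> a character at the limit points
    too.\<close>
  have kernel: "cis (2 * pi * apply_bcontfun v t) = 1" if "(0, v) \<in> P" "t \<in> closure (\<psi> ` dual_group)" for v t
  proof -
    have "cis (2 * pi * apply_bcontfun v (\<psi> x)) = 1" if "x \<in> dual_group" for x
      using P(4) [OF \<open>(0, v) \<in> P\<close>] that by (simp add: P0_def dual_group_zero)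
    moreover have "continuous_on (closure (\<psi> ` dual_group)) (\<lambda>t. cis (2 * pi * apply_bcontfun v t))"
      by (intro continuous_intros continuous_on_subset [OF continuous_on_apply_bcontfun]) auto
    ultimately show ?thesis
      using continuous_constant_on_closure [of "\<psi> ` dual_group" "\<lambda>t. cis (2 * pi * apply_bcontfun v t)" 1 t] that(2)
      by blast
  qed
  have val: "f t \<gamma> = cis (2 * pi * apply_bcontfun v t)" if "(\<gamma>, v) \<in> P" "t \<in> closure (\<psi> ` dual_group)" for \<gamma> v t
  proof -
    have "(0, V \<gamma> - v) \<in> P" using add_subgroup_diff [OF P(1) V [of \<gamma>] that(1)] by simp
    then have "cis (2 * pi * apply_bcontfun (V \<gamma> - v) t) = 1" by (rule kernel [OF _ that(2)])
    moreover have "cis (2 * pi * apply_bcontfun (V \<gamma>) t) = cis (2 * pi * apply_bcontfun (V \<gamma> - v) t) * cis (2 * pi * apply_bcontfun v t)"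
      by (simp add: cis_mult algebra_simps)
    ultimately show ?thesis by (simp add: f_def)
  qed
  have "f t \<in> dual_group" if t: "t \<in> closure (\<psi> ` dual_group)" for t
  proof -
    have "f t (\<gamma> + \<delta>) = f t \<gamma> * f t \<delta>" for \<gamma> \<delta>
    proof -
      have "(\<gamma> + \<delta>, V \<gamma> + V \<delta>) \<in> P" using add_subgroup_add [OF P(1) V V] by simp
      from val [OF this t] show ?thesis by (simp add: f_def cis_mult algebra_simps)
    qed
    then show ?thesis by (simp add: dual_group_def f_def)
  qed
  moreover have "f t (h i) = cis (2 * pi * u i t)" if t: "t \<in> closure (\<psi> ` dual_group)" for t i
  proof -
    have b: "u i \<in> bcontfun"
      using u by (intro bcontfun_normI [of _ 1]) auto
    then have "(h i, Bcontfun (u i)) \<in> P0"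
      using \<psi> by (simp add: P0_def Bcontfun_inverse)
    then show ?thesis using val [OF _ t] P(2) b by (metis Bcontfun_inverse subsetD)
  qed
  moreover have "continuous_on UNIV f"
    unfolding f_def by (intro continuous_on_coordinatewise_then_product continuous_intros
      continuous_on_subset [OF continuous_on_apply_bcontfun]) auto
  ultimately show ?thesis by blast
qed

text \<open>The function type is not an instance of the Hausdorff class, so \<open>compact_imp_closed\<close> does not apply.\<close>

lemma compact_fun_imp_closed:
  fixes C :: "('b \<Rightarrow> 'c::metric_space) set"
  assumes "compact C"
  shows "closed C"
proof -
  have "Hausdorff_space (product_topology (\<lambda>_ :: 'b. euclidean :: 'c topology) UNIV)"
    by (simp add: Hausdorff_space_product_topology Hausdorff_space_euclidean)
  then have "Hausdorff_space (euclidean :: ('b \<Rightarrow> 'c) topology)"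
    by (simp add: euclidean_product_topology)
  then show ?thesis
    using assms compactin_imp_closedin [of euclidean C] by simp
qed

lemma compact_inner_approximation:
  fixes M :: "real measure"
  assumes M: "real_distribution M" and B: "B \<in> sets borel" and \<epsilon>: "0 < \<epsilon>"
  shows "\<exists>C\<subseteq>B. compact C \<and> measure M (B - C) < \<epsilon>"
proof (cases "measure M B = 0")
  case True
  then show ?thesis using \<epsilon> by (intro exI [of _ "{}"]) simp
next
  case False
  interpret M: real_distribution M by (rule M)
  have "0 < measure M B" using False by (simp add: zero_less_measure_iff)
  then have "ennreal (measure M B - \<epsilon>) < ennreal (measure M B)"
    using \<epsilon> by (intro ennreal_lessI) auto
  also have "\<dots> = (SUP C \<in> {C. C \<subseteq> B \<and> compact C}. emeasure M C)"
    using inner_regular [of M B] B by (simp add: M.emeasure_eq_measure)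
  finally obtain C where C: "C \<subseteq> B" "compact C" "ennreal (measure M B - \<epsilon>) < emeasure M C"
    unfolding less_SUP_iff by blast
  then have "measure M B - \<epsilon> < measure M C"
    by (metis M.emeasure_eq_measure ennreal_leI not_less)
  moreover have "measure M (B - C) = measure M B - measure M C"
    using B C by (intro M.finite_measure_Diff) (auto intro: borel_compact)
  ultimately show ?thesis using C by (intro exI [of _ C]) auto
qed

text \<open>Inner regularity is inherited from the line: compact subsets of a preimage have compact
  images under \<open>f\<close>. The topology of the dual group enters only through continuity of
  \<open>f\<close>.\<close>

lemma pushforward_to_dual:
  fixes f :: "real \<Rightarrow> 'a::ab_group_add \<Rightarrow> complex"
  assumes M: "real_distribution M" and K: "closed K" "AE t in M. t \<in> K"
    and f: "continuous_on UNIV f" "f ` K \<subseteq> dual_group"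
  shows "\<exists>N. prob_space N \<and> sets N = sets dual_borel \<and> (\<forall>\<gamma>. (LINT x|N. x \<gamma>) = (LINT t|M. f t \<gamma>)) \<and>
    (\<forall>A\<in>sets dual_borel. \<forall>\<epsilon>>0. \<exists>C\<subseteq>A. compact C \<and> measure N (A - C) < \<epsilon>)"
proof -
  interpret M: real_distribution M by (rule M)
  \<comment> \<open>The trivial character is a default value on a null set; it makes the map take
    values in the dual group everywhere.\<close>
  define f' where "f' t = (if t \<in> K then f t else (\<lambda>_. 1))" for t
  have one: "(\<lambda>_. 1) \<in> dual_group" by (simp add: dual_group_def)
  have "f' \<in> borel_measurable borel"
    unfolding f'_def using K(1) f(1)
    by (intro measurable_If borel_measurable_continuous_onI) (auto intro: borel_closed)
  then have f' [measurable]: "f' \<in> measurable M dual_borel"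
    unfolding dual_borel_def using image_subset_iff [THEN iffD1, OF f(2)] one
    by (intro measurable_restrict_space2) (auto simp: f'_def)
  define N where "N = distr M dual_borel f'"
  have N: "prob_space N" unfolding N_def by (rule M.prob_space_distr) (rule f')
  have "(LINT x|N. x \<gamma>) = (LINT t|M. f t \<gamma>)" for \<gamma>
  proof -
    have "(\<lambda>t. f t \<gamma>) \<in> borel_measurable borel"
      by (rule borel_measurable_continuous_onI
        [OF continuous_on_compose2 [OF continuous_on_product_coordinates f(1) subset_UNIV]])
    then have [measurable]: "(\<lambda>t. f t \<gamma>) \<in> borel_measurable M" by simp
    have [measurable]: "(\<lambda>t. f' t \<gamma>) \<in> borel_measurable M"
      by (rule measurable_compose [OF f' measurable_evaluation])
    have "(LINT x|N. x \<gamma>) = (LINT t|M. f' t \<gamma>)"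
      unfolding N_def by (intro integral_distr) simp_all
    also have "\<dots> = (LINT t|M. f t \<gamma>)"
    proof (rule integral_cong_AE)
      show "AE t in M. f' t \<gamma> = f t \<gamma>"
        using K(2) by (rule eventually_mono) (simp add: f'_def)
    qed simp_all
    finally show ?thesis .
  qed
  moreover have "\<exists>C\<subseteq>A. compact C \<and> measure N (A - C) < \<epsilon>" if A: "A \<in> sets dual_borel" and \<epsilon>: "0 < \<epsilon>" for A \<epsilon>
  proof -
    \<comment> \<open>Intersecting with \<open>K\<close> ensures that the map agrees on
      \<open>C\<close> with the continuous \<open>f\<close>.\<close>
    define B where "B = f' -` A \<inter> K"
    have B: "B \<in> sets borel"
      using measurable_sets [OF f' A] K(1) by (auto simp: B_def intro!: sets.Int borel_closed)
    obtain C where C: "C \<subseteq> B" "compact C" "measure M (B - C) < \<epsilon>"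
      using compact_inner_approximation [OF M B \<epsilon>] by blast
    have fC: "f' t = f t" if "t \<in> C" for t using C(1) that by (auto simp: f'_def B_def)
    have com: "compact (f ` C)"
      using f(1) C(2) continuous_on_subset by (blast intro: compact_continuous_image)
    have sub: "f ` C \<subseteq> A" using fC C(1) by (fastforce simp: B_def)
    have "f ` C \<in> sets borel" using com by (intro borel_closed compact_fun_imp_closed)
    moreover have "A \<subseteq> dual_group" using sets.sets_into_space [OF A] by simp
    ultimately have fCs: "f ` C \<in> sets dual_borel"
      using sub unfolding dual_borel_def sets_restrict_space by (intro image_eqI [of _ _ "f ` C"]) auto
    have Cs: "C \<in> sets borel" using C(2) by (rule borel_compact)
    have "measure N (A - f ` C) = measure M (f' -` (A - f ` C) \<inter> space M)"
      unfolding N_def using A fCs by (intro measure_distr) auto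
    also have "\<dots> \<le> measure M (B - C)"
    proof (rule M.finite_measure_mono_AE)
      show "AE t in M. t \<in> f' -` (A - f ` C) \<inter> space M \<longrightarrow> t \<in> B - C"
        using K(2) by (rule eventually_mono) (auto simp: B_def fC)
    qed (use B Cs in simp)
    finally show ?thesis using sub com C(3) by (intro exI [of _ "f ` C"]) auto
  qed
  ultimately show ?thesis using N by (intro exI [of _ N]) (simp add: N_def)
qed

text \<open>Outer approximation is inner approximation of the complement: \<open>U\<close> is the
  complement of a compact set \<open>D\<close> that nearly exhausts
  \<open>dual_group - A\<close>.\<close>

lemma inner_approximation_imp_regular:
  assumes N: "finite_measure N" "sets N = sets dual_borel"
    and inner: "\<forall>A\<in>sets dual_borel. \<forall>\<epsilon>>0. \<exists>C\<subseteq>A. compact C \<and> measure N (A - C) < \<epsilon>"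
    and A: "A \<in> sets dual_borel" and \<epsilon>: "0 < \<epsilon>"
  shows "\<exists>C U. compact C \<and> openin (top_of_set dual_group) U \<and> C \<subseteq> A \<and> A \<subseteq> U \<and> U \<in> sets dual_borel \<and>
    C \<in> sets dual_borel \<and> measure N (U - C) < \<epsilon>"
proof -
  interpret N: finite_measure N by (rule N(1))
  have Ad: "A \<subseteq> dual_group" using sets.sets_into_space [OF A] by simp
  have Ac: "dual_group - A \<in> sets dual_borel" using sets.compl_sets [OF A] by simp
  have comp: "C \<in> sets dual_borel" if "compact C" "C \<subseteq> dual_group" for C
    using that unfolding dual_borel_def sets_restrict_space
    by (intro image_eqI [of _ _ C]) (auto intro: borel_closed compact_fun_imp_closed)
  obtain C where C: "C \<subseteq> A" "compact C" "measure N (A - C) < \<epsilon> / 2"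
    using inner [rule_format, OF A, of "\<epsilon> / 2"] \<epsilon> by auto
  obtain D where D: "D \<subseteq> dual_group - A" "compact D" "measure N ((dual_group - A) - D) < \<epsilon> / 2"
    using inner [rule_format, OF Ac, of "\<epsilon> / 2"] \<epsilon> by auto
  have Cs: "C \<in> sets dual_borel" using C Ad by (intro comp) auto
  have Ds: "D \<in> sets dual_borel" using D by (intro comp) auto
  have top: "dual_group \<in> sets dual_borel" using sets.top [of dual_borel] by simp
  have eq: "dual_group - D - C = (A - C) \<union> ((dual_group - A) - D)" using C(1) D(1) Ad by blast
  have "measure N (dual_group - D - C) \<le> measure N (A - C) + measure N ((dual_group - A) - D)"
    unfolding eq using A Ac Cs Ds N(2) by (intro measure_Un_le) auto
  then have "measure N (dual_group - D - C) < \<epsilon>" using C(3) D(3) by simp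
  moreover have "openin (top_of_set dual_group) (dual_group - D)"
    using D(2) by (auto simp: openin_open intro!: exI [of _ "- D"] open_Compl compact_fun_imp_closed)
  ultimately show ?thesis
    using C D Ad Cs Ds top by (intro exI [of _ C] exI [of _ "dual_group - D"]) auto
qed

subsection \<open>Interpolation by Riesz products\<close>

lemma weighted_sum_append: "weighted_sum (L @ L') f = weighted_sum L f + weighted_sum L' f"
  by (simp add: weighted_sum_def)

lemma weighted_sum_scale: "weighted_sum (map (\<lambda>(w, x). (r * w, x)) L) f = r *\<^sub>R weighted_sum L f"
  by (induction L) (auto simp: weighted_sum_def scaleR_right_distrib)

lemma finite_prob_average:
  assumes "finite_prob L" "finite_prob L'"
  obtains L'' where "finite_prob L''" "snd ` set L'' = snd ` set L \<union> snd ` set L'"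
    "\<And>f :: 'b \<Rightarrow> complex. weighted_sum L'' f = (weighted_sum L f + weighted_sum L' f) / 2"
proof
  let ?L = "map (\<lambda>(w, x). (1 / 2 * w, x)) L @ map (\<lambda>(w, x). (1 / 2 * w, x)) L'"
  show "finite_prob ?L"
    using assms unfolding finite_prob_def weighted_sum_append weighted_sum_scale by auto
  show "snd ` set ?L = snd ` set L \<union> snd ` set L'" by force
  show "weighted_sum ?L f = (weighted_sum L f + weighted_sum L' f) / 2" for f :: "'b \<Rightarrow> complex"
    unfolding weighted_sum_append weighted_sum_scale by (simp add: scaleR_conv_of_real add_divide_distrib)
qed

lemma two_riesz_finite_prob:
  fixes d e :: "nat \<Rightarrow> 'a::ab_group_add" and \<tau> :: "'a \<Rightarrow> real"
  assumes d: "dissociate d" and e: "dissociate e"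
    and ed: "\<And>k n. e k \<notin> riesz_span d n" and de: "\<And>k n. d k \<notin> riesz_span e n"
    and \<tau>: "\<And>\<gamma>. \<bar>\<tau> \<gamma>\<bar> \<le> 1 / 4"
  shows "\<exists>L. finite_prob L \<and> snd ` set L \<subseteq> dual_group \<and>
    (\<forall>k<n. weighted_sum L (\<lambda>x. x (d k)) = of_real (\<tau> (d k)) \<and> weighted_sum L (\<lambda>x. x (e k)) = of_real (\<tau> (e k)))"
proof -
  \<comment> \<open>Solves the formula for the coefficient at a generator with target
    \<open>2 * \<tau> (g k)\<close>; the factor 2 is lost again in the average, as the other product
    has coefficient 0 there. The bound 1/4 gives \<open>\<bar>c g k\<bar> \<le> 1\<close>.\<close>
  define c where "c g k = 2 * \<tau> (g k) / (if g k + g k = 0 then 1 else 1 / 2)" for g :: "nat \<Rightarrow> 'a" and k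
  have c: "\<bar>c g k\<bar> \<le> 1" for g k using \<tau> [of "g k"] by (auto simp: c_def abs_mult)
  define F where "F = d ` {..<n} \<union> e ` {..<n}"
  have F: "finite F" by (simp add: F_def)
  have coeff: "riesz_coeff (c g) g n (g k) = 2 * \<tau> (g k)" if "dissociate g" "k < n" for g k
    using riesz_coeff_at_generator [OF that, of "c g"] by (simp add: c_def)
  obtain L1 where L1: "finite_prob L1" "snd ` set L1 \<subseteq> dual_group"
    "\<And>\<gamma>. \<gamma> \<in> F \<Longrightarrow> weighted_sum L1 (\<lambda>x. x \<gamma>) = complex_of_real (riesz_coeff (c d) d n \<gamma>)"
    by (rule finite_riesz_measure [OF F d c]) (rule that; assumption)
  obtain L2 where L2: "finite_prob L2" "snd ` set L2 \<subseteq> dual_group"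
    "\<And>\<gamma>. \<gamma> \<in> F \<Longrightarrow> weighted_sum L2 (\<lambda>x. x \<gamma>) = complex_of_real (riesz_coeff (c e) e n \<gamma>)"
    by (rule finite_riesz_measure [OF F e c]) (rule that; assumption)
  obtain L where L: "finite_prob L" "snd ` set L = snd ` set L1 \<union> snd ` set L2"
    "\<And>f :: ('a \<Rightarrow> complex) \<Rightarrow> complex. weighted_sum L f = (weighted_sum L1 f + weighted_sum L2 f) / 2"
    by (rule finite_prob_average [OF L1(1) L2(1)]) (rule that; assumption)
  have "weighted_sum L (\<lambda>x. x (d k)) = of_real (\<tau> (d k))" "weighted_sum L (\<lambda>x. x (e k)) = of_real (\<tau> (e k))"
    if "k < n" for k
    using L1(3) [of "d k"] L1(3) [of "e k"] L2(3) [of "d k"] L2(3) [of "e k"] that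
    by (simp_all add: F_def L(3) coeff d e riesz_coeff_support ed de)
  then show ?thesis using L(1,2) L1(2) L2(2) by (intro exI [of _ L]) auto
qed

lemma dual_probability_with_coefficients:
  fixes h :: "nat \<Rightarrow> 'a::ab_group_add" and l :: "nat \<Rightarrow> complex"
  assumes L: "\<And>n. finite_prob (L n)" "\<And>n. snd ` set (L n) \<subseteq> dual_group"
    and lim: "\<And>i. (\<lambda>n. weighted_sum (L n) (\<lambda>x. x (h i))) \<longlonglongrightarrow> l i"
  shows "\<exists>N. prob_space N \<and> sets N = sets dual_borel \<and> (\<forall>i. (LINT x|N. x (h i)) = l i) \<and>
    (\<forall>A\<in>sets dual_borel. \<forall>\<epsilon>>0. \<exists>C\<subseteq>A. compact C \<and> measure N (A - C) < \<epsilon>)"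
proof -
  from continuous_onto_cube obtain u :: "nat \<Rightarrow> real \<Rightarrow> real"
    where u: "\<forall>i. continuous_on UNIV (u i)" "\<forall>i t. \<bar>u i t\<bar> \<le> 1"
      "\<forall>\<theta>. (\<forall>i. 0 \<le> \<theta> i \<and> \<theta> i < 1) \<longrightarrow> (\<exists>t\<in>{0..1}. \<forall>i. u i t = \<theta> i)"
    by (elim exE conjE) (rule that)
  have ex: "\<exists>t\<in>{0..1}. \<forall>i. cis (2 * pi * u i t) = x (h i)" if x: "x \<in> dual_group" for x
  proof -
    define \<theta> where "\<theta> i = Arg2pi (x (h i)) / (2 * pi)" for i
    have "0 \<le> \<theta> i \<and> \<theta> i < 1" for i
      using Arg2pi_ge_0 [of "x (h i)"] Arg2pi_lt_2pi [of "x (h i)"] by (simp add: \<theta>_def)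
    then obtain t where t: "t \<in> {0..1}" "\<forall>i. u i t = \<theta> i" using u(3) by blast
    have "cis (2 * pi * u i t) = x (h i)" for i
      using t(2) Arg2pi_eq [of "x (h i)"] dual_group_norm [OF x] by (simp add: \<theta>_def cis_conv_exp)
    then show ?thesis using t(1) by blast
  qed
  \<comment> \<open>A real code for the values of \<open>x\<close> at all \<open>h i\<close>: their
    normalised arguments, combined through the map onto the cube.\<close>
  define \<psi> where "\<psi> x = (SOME t. t \<in> {0..1} \<and> (\<forall>i. cis (2 * pi * u i t) = x (h i)))" for x
  have \<psi>: "\<psi> x \<in> {0..1} \<and> (\<forall>i. cis (2 * pi * u i (\<psi> x)) = x (h i))" if "x \<in> dual_group" for x
    unfolding \<psi>_def by (rule someI_ex) (use ex [OF that] in blast)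
  have \<psi>01: "\<psi> ` dual_group \<subseteq> {0..1}" using \<psi> by blast
  obtain M where M: "real_distribution M" "AE t in M. t \<in> closure (\<psi> ` dual_group)"
    and Mlim: "\<forall>(f :: real \<Rightarrow> complex) B l. continuous_on UNIV f \<longrightarrow> (\<forall>t. cmod (f t) \<le> B) \<longrightarrow>
      (\<lambda>n. weighted_sum (L n) (\<lambda>x. f (\<psi> x))) \<longlonglongrightarrow> l \<longrightarrow> (LINT t|M. f t) = l"
    using finite_prob_weak_limit [of L dual_group \<psi>, OF L \<psi>01] by (elim exE conjE) (rule that)
  obtain f where f: "continuous_on UNIV f"
    "\<forall>t\<in>closure (\<psi> ` dual_group). f t \<in> dual_group \<and> (\<forall>i. f t (h i) = cis (2 * pi * u i t))"
    using continuous_character_family [of u \<psi> h] u(1,2) \<psi> by (metis (no_types, lifting))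
  have fK: "f ` closure (\<psi> ` dual_group) \<subseteq> dual_group" using f(2) by blast
  obtain N where N: "prob_space N" "sets N = sets dual_borel" "\<forall>\<gamma>. (LINT x|N. x \<gamma>) = (LINT t|M. f t \<gamma>)"
    "\<forall>A\<in>sets dual_borel. \<forall>\<epsilon>>0. \<exists>C\<subseteq>A. compact C \<and> measure N (A - C) < \<epsilon>"
    using pushforward_to_dual [OF M(1) closed_closure M(2) f(1) fK] by (elim exE conjE) (rule that)
  interpret M: real_distribution M by (rule M(1))
  have "(LINT x|N. x (h i)) = l i" for i
  proof -
    have cont: "continuous_on UNIV (\<lambda>t. cis (2 * pi * u i t))" using u(1) by (intro continuous_intros) auto
    have fc: "continuous_on UNIV (\<lambda>t. f t (h i))"
      by (rule continuous_on_compose2 [OF continuous_on_product_coordinates f(1) subset_UNIV])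
    have "(LINT x|N. x (h i)) = (LINT t|M. f t (h i))" using N(3) by blast
    also have "\<dots> = (LINT t|M. cis (2 * pi * u i t))"
    proof (rule integral_cong_AE)
      show "AE t in M. f t (h i) = cis (2 * pi * u i t)"
        using M(2) by (rule eventually_mono) (use f(2) in blast)
    qed (use borel_measurable_continuous_onI [OF fc] borel_measurable_continuous_onI [OF cont] in simp_all)
    also have "\<dots> = l i"
    proof -
      have "weighted_sum (L n) (\<lambda>x. cis (2 * pi * u i (\<psi> x))) = weighted_sum (L n) (\<lambda>x. x (h i))" for n
        by (rule weighted_sum_cong) (use \<psi> L(2) in blast)
      then show ?thesis using Mlim [rule_format, OF cont, of 1 "l i"] lim [of i] by simp
    qed
    finally show ?thesis .
  qed
  then show ?thesis using N by (intro exI [of _ N]) simp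
qed

lemma dual_probability_interpolating:
  fixes d e :: "nat \<Rightarrow> 'a::ab_group_add" and \<tau> :: "'a \<Rightarrow> real"
  assumes "dissociate d" "dissociate e"
    and "\<And>k n. e k \<notin> riesz_span d n" "\<And>k n. d k \<notin> riesz_span e n"
    and "\<And>\<gamma>. \<bar>\<tau> \<gamma>\<bar> \<le> 1 / 4"
  shows "\<exists>N. prob_space N \<and> sets N = sets dual_borel \<and>
    (\<forall>\<gamma>\<in>range d \<union> range e. (LINT x|N. x \<gamma>) = of_real (\<tau> \<gamma>)) \<and>
    (\<forall>A\<in>sets dual_borel. \<forall>\<epsilon>>0. \<exists>C\<subseteq>A. compact C \<and> measure N (A - C) < \<epsilon>)"
proof -
  define h where "h i = (if even i then d (i div 2) else e (i div 2))" for i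
  have h: "range d \<union> range e \<subseteq> range h"
  proof -
    have "d k = h (2 * k)" "e k = h (2 * k + 1)" for k by (simp_all add: h_def)
    then show ?thesis by blast
  qed
  from two_riesz_finite_prob [OF assms] have "\<forall>n. \<exists>L. finite_prob L \<and> snd ` set L \<subseteq> dual_group \<and>
      (\<forall>k<n. weighted_sum L (\<lambda>x. x (d k)) = of_real (\<tau> (d k)) \<and>
        weighted_sum L (\<lambda>x. x (e k)) = of_real (\<tau> (e k)))" by (rule allI)
  from choice [OF this] obtain L where
    "\<forall>n. finite_prob (L n) \<and> snd ` set (L n) \<subseteq> dual_group \<and>
      (\<forall>k<n. weighted_sum (L n) (\<lambda>x. x (d k)) = of_real (\<tau> (d k)) \<and>
        weighted_sum (L n) (\<lambda>x. x (e k)) = of_real (\<tau> (e k)))" by (elim exE) (rule that)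
  then have L: "finite_prob (L n)" "snd ` set (L n) \<subseteq> dual_group"
    and val: "k < n \<Longrightarrow> weighted_sum (L n) (\<lambda>x. x (d k)) = of_real (\<tau> (d k)) \<and>
      weighted_sum (L n) (\<lambda>x. x (e k)) = of_real (\<tau> (e k))" for n k
    by blast+
  \<comment> \<open>Stage \<open>n\<close> is already exact at the first \<open>n\<close> terms of
    both sequences, so each of these sequences is eventually constant.\<close>
  have "(\<lambda>n. weighted_sum (L n) (\<lambda>x. x (h i))) \<longlonglongrightarrow> of_real (\<tau> (h i))" for i
  proof (rule tendsto_eventually)
    show "\<forall>\<^sub>F n in sequentially. weighted_sum (L n) (\<lambda>x. x (h i)) = of_real (\<tau> (h i))"
      using eventually_gt_at_top [of "i div 2"] by (rule eventually_mono) (use val in \<open>auto simp: h_def\<close>)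
  qed
  from dual_probability_with_coefficients [of L h "\<lambda>i. of_real (\<tau> (h i))", OF L this]
  obtain N where N: "prob_space N" "sets N = sets dual_borel"
    "\<forall>i. (LINT x|N. x (h i)) = of_real (\<tau> (h i))"
    "\<forall>A\<in>sets dual_borel. \<forall>\<epsilon>>0. \<exists>C\<subseteq>A. compact C \<and> measure N (A - C) < \<epsilon>"
    by (elim exE conjE) (rule that)
  have "\<forall>\<gamma>\<in>range d \<union> range e. (LINT x|N. x \<gamma>) = of_real (\<tau> \<gamma>)"
  proof
    fix \<gamma> assume "\<gamma> \<in> range d \<union> range e"
    then obtain i where "\<gamma> = h i" using h by blast
    then show "(LINT x|N. x \<gamma>) = of_real (\<tau> \<gamma>)" using N(3) by simp
  qed
  then show ?thesis using N(1,2,4) by (intro exI [of _ N]) simp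
qed

section \<open>From probability measures to regular complex measures\<close>

lemma signed_integral_scaled_measure:
  assumes N: "finite_measure N" "sets N = sets M" and s: "0 \<le> s" and f: "f \<in> borel_measurable M"
  shows "signed_integral M (\<lambda>A. s * measure N A) f = s *\<^sub>R (LINT x|N. f x)"
proof -
  interpret N: finite_measure N by (rule N(1))
  have sp: "space N = space M" using N(2) by (rule sets_eq_imp_space_eq)
  have sig: "sigma_sets (space M) (sets M) = sets M" by (rule sets.sigma_sets_eq)
  \<comment> \<open>For a nonnegative measure the supremum over subsets of \<open>A\<close> is
    attained at \<open>A\<close>, so the positive variation is the measure itself.\<close>
  have pos: "(SUP B \<in> {B \<in> sets M. B \<subseteq> A}. ennreal (s * measure N B)) = emeasure (density N (\<lambda>_. ennreal s)) A"
    if A: "A \<in> sets M" for A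
  proof -
    have "(SUP B \<in> {B \<in> sets M. B \<subseteq> A}. ennreal (s * measure N B)) = ennreal (s * measure N A)"
      using A s N(2)
      by (intro antisym SUP_least SUP_upper) (auto intro!: ennreal_leI mult_left_mono N.finite_measure_mono)
    also have "\<dots> = emeasure (density N (\<lambda>_. ennreal s)) A"
      using A N(2) s by (simp add: emeasure_density_const N.emeasure_eq_measure ennreal_mult)
    finally show ?thesis .
  qed
  have "positive_variation M (\<lambda>A. s * measure N A) = measure_of (space M) (sets M) (emeasure (density N (\<lambda>_. ennreal s)))"
    unfolding positive_variation_def by (rule measure_of_eq [OF sets.space_closed]) (simp only: sig pos)
  also have "\<dots> = density N (\<lambda>_. ennreal s)"
    using measure_of_of_measure [of "density N (\<lambda>_. ennreal s)"] N(2) sp by simp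
  finally have p: "positive_variation M (\<lambda>A. s * measure N A) = density N (\<lambda>_. ennreal s)" .
  have "positive_variation M (\<lambda>A. - (s * measure N A)) \<le> null_measure M"
  proof (rule positive_variation_le)
    show "ennreal (- (s * measure N B)) \<le> emeasure (null_measure M) B" for B
      using s by (simp add: ennreal_neg)
  qed simp
  then have "emeasure (positive_variation M (\<lambda>A. - (s * measure N A))) A = 0" for A
    using le_measureD3 [of _ "null_measure M" A] by simp
  then have n: "positive_variation M (\<lambda>A. - (s * measure N A)) = null_measure M"
    by (intro measure_eqI) simp_all
  have "f \<in> borel_measurable N" using f measurable_cong_sets [OF N(2) refl] by blast
  then have "(LINT x|density N (\<lambda>_. ennreal s). f x) = s *\<^sub>R (LINT x|N. f x)"
    using s by (subst integral_density) auto
  moreover have "(LINT x|null_measure M. f x) = 0"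
  proof -
    have "AE x in null_measure M. f x = 0"
      by (rule AE_I [of _ _ "space M"]) auto
    then show ?thesis by (rule integral_eq_zero_AE)
  qed
  ultimately show ?thesis by (simp add: signed_integral_def p n)
qed

lemma sum_measure_partition:
  assumes N: "finite_measure N" and P: "finite P" "P \<subseteq> sets N" "disjoint P"
  shows "(\<Sum>B\<in>P. measure N B) = measure N (\<Union>P)"
proof -
  interpret finite_measure N by (rule N)
  have "disjoint_family_on (\<lambda>B. B) P"
    using P(3) by (auto simp: disjoint_def disjoint_family_on_def)
  then show ?thesis
    using finite_measure_finite_Union [of P "\<lambda>B. B"] P by auto
qed

lemma regular_dual_measure_combination:
  fixes N1 N2 :: "('a::ab_group_add \<Rightarrow> complex) measure"
  assumes N1: "finite_measure N1" "sets N1 = sets dual_borel"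
    and N2: "finite_measure N2" "sets N2 = sets dual_borel"
    and inner1: "\<forall>A\<in>sets dual_borel. \<forall>\<epsilon>>0. \<exists>C\<subseteq>A. compact C \<and> measure N1 (A - C) < \<epsilon>"
    and inner2: "\<forall>A\<in>sets dual_borel. \<forall>\<epsilon>>0. \<exists>C\<subseteq>A. compact C \<and> measure N2 (A - C) < \<epsilon>"
    and s: "0 < s"
  shows "regular_dual_measure (\<lambda>A. Complex (s * measure N1 A) (s * measure N2 A))"
    (is "regular_dual_measure ?\<mu>")
  unfolding regular_dual_measure_def
proof (intro conjI ballI allI impI)
  interpret N1: finite_measure N1 by (rule N1)
  interpret N2: finite_measure N2 by (rule N2)
  show "complex_measure dual_borel ?\<mu>"
    unfolding complex_measure_def
  proof (intro allI impI)
    fix A :: "nat \<Rightarrow> ('a \<Rightarrow> complex) set"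
    assume "range A \<subseteq> sets dual_borel" "disjoint_family A"
    then have "(\<lambda>n. measure N1 (A n)) sums measure N1 (\<Union>n. A n)" "(\<lambda>n. measure N2 (A n)) sums measure N2 (\<Union>n. A n)"
      using N1(2) N2(2) by (auto intro: N1.finite_measure_UNION N2.finite_measure_UNION)
    then show "(\<lambda>n. ?\<mu> (A n)) sums ?\<mu> (\<Union>n. A n)"
      unfolding sums_complex_iff complex.sel by (intro conjI sums_mult)
  qed
  fix A \<epsilon> assume A: "A \<in> sets (dual_borel :: ('a \<Rightarrow> complex) measure)" and \<epsilon>: "(0 :: ennreal) < \<epsilon>"
  obtain e where e: "0 < e" "ennreal e \<le> \<epsilon>"
  proof (cases \<epsilon>)
    case (real r)
    then show thesis using that [of r] \<epsilon> by simp
  next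
    case top
    then show thesis using that [of 1] by simp
  qed
  \<comment> \<open>Both components together contribute at most
    \<open>2 * s * \<eta> = e / 2\<close>, strictly below \<open>e\<close>. The real
    \<open>e\<close> replaces \<open>\<epsilon>\<close>, which may be infinite.\<close>
  define \<eta> where "\<eta> = e / (4 * s)"
  have \<eta>: "0 < \<eta>" using e s by (simp add: \<eta>_def)
  obtain C1 U1 where 1: "compact C1" "openin (top_of_set dual_group) U1" "C1 \<subseteq> A" "A \<subseteq> U1"
    "U1 \<in> sets dual_borel" "C1 \<in> sets dual_borel" "measure N1 (U1 - C1) < \<eta>"
    using inner_approximation_imp_regular [OF N1 inner1 A \<eta>] by (elim exE conjE) (rule that)
  obtain C2 U2 where 2: "compact C2" "openin (top_of_set dual_group) U2" "C2 \<subseteq> A" "A \<subseteq> U2"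
    "U2 \<in> sets dual_borel" "C2 \<in> sets dual_borel" "measure N2 (U2 - C2) < \<eta>"
    using inner_approximation_imp_regular [OF N2 inner2 A \<eta>] by (elim exE conjE) (rule that)
  define D where "D = (U1 \<inter> U2) - (C1 \<union> C2)"
  have D: "measure N1 D < \<eta>" "measure N2 D < \<eta>"
    using N1.finite_measure_mono [of D "U1 - C1"] N2.finite_measure_mono [of D "U2 - C2"] 1 2 N1(2) N2(2)
    by (force simp: D_def)+
  have "total_variation dual_borel ?\<mu> D \<le> ennreal (2 * s * \<eta>)"
    unfolding total_variation_def
  proof (rule SUP_least, clarify)
    fix P assume P: "finite P" "P \<subseteq> sets dual_borel" "disjoint P" "D = \<Union>P"
    have "cmod (?\<mu> B) \<le> s * measure N1 B + s * measure N2 B" for B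
      using cmod_le [of "?\<mu> B"] s by (simp add: abs_mult)
    then have "(\<Sum>B\<in>P. cmod (?\<mu> B)) \<le> (\<Sum>B\<in>P. s * measure N1 B + s * measure N2 B)"
      by (rule sum_mono)
    also have "\<dots> = s * measure N1 D + s * measure N2 D"
      using sum_measure_partition [OF N1(1) P(1)] sum_measure_partition [OF N2(1) P(1)] P N1(2) N2(2)
      by (simp add: sum.distrib sum_distrib_left [symmetric])
    also have "\<dots> \<le> s * \<eta> + s * \<eta>"
      using D s by (intro add_mono mult_left_mono) auto
    finally have "ennreal (\<Sum>B\<in>P. cmod (?\<mu> B)) \<le> ennreal (2 * s * \<eta>)"
      by (intro ennreal_leI) (simp add: mult.commute)
    then show "(\<Sum>B\<in>P. ennreal (cmod (?\<mu> B))) \<le> ennreal (2 * s * \<eta>)"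
      by (subst sum_ennreal) simp_all
  qed
  also have "ennreal (2 * s * \<eta>) < ennreal e" using e(1) s by (intro ennreal_lessI) (simp_all add: \<eta>_def)
  also note e(2)
  finally have "total_variation dual_borel ?\<mu> ((U1 \<inter> U2) - (C1 \<union> C2)) < \<epsilon>" by (simp add: D_def)
  then show "\<exists>C U. compact C \<and> openin (top_of_set dual_group) U \<and> C \<subseteq> A \<and> A \<subseteq> U \<and>
      total_variation dual_borel ?\<mu> (U - C) < \<epsilon>"
    using 1 2 by (intro exI [of _ "C1 \<union> C2"] exI [of _ "U1 \<inter> U2"]) auto
qed

lemma Sidon_set_two_dissociate:
  fixes d e :: "nat \<Rightarrow> 'a::ab_group_add"
  assumes de: "dissociate d" "dissociate e" "\<And>k n. e k \<notin> riesz_span d n" "\<And>k n. d k \<notin> riesz_span e n"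
  shows "Sidon_set (range d \<union> range e)"
  unfolding Sidon_set_def
proof (intro allI impI)
  fix \<phi> :: "'a \<Rightarrow> complex"
  let ?E = "range d \<union> range e"
  assume "bounded (\<phi> ` ?E)"
  then obtain B where B: "0 < B" "\<And>\<gamma>. \<gamma> \<in> ?E \<Longrightarrow> cmod (\<phi> \<gamma>) \<le> B"
    unfolding bounded_pos by auto
  define s where "s = 4 * B"
  define \<tau> where "\<tau> p \<gamma> = (if \<gamma> \<in> ?E then p (\<phi> \<gamma>) / s else 0 :: real)" for p \<gamma>
  have s: "0 < s" using B by (simp add: s_def)
  have \<tau>: "\<bar>\<tau> p \<gamma>\<bar> \<le> 1 / 4" if "\<And>z. \<bar>p z\<bar> \<le> cmod z" for p \<gamma>
    using B(1) B(2) [of \<gamma>] that [of "\<phi> \<gamma>"] by (auto simp: \<tau>_def s_def abs_mult divide_simps)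
  have ex: "\<exists>N. prob_space N \<and> sets N = sets dual_borel \<and>
    (\<forall>\<gamma>\<in>?E. (LINT x|N. x \<gamma>) = of_real (\<tau> p \<gamma>)) \<and>
    (\<forall>A\<in>sets dual_borel. \<forall>\<epsilon>>0. \<exists>C\<subseteq>A. compact C \<and> measure N (A - C) < \<epsilon>)"
    if "\<And>z. \<bar>p z\<bar> \<le> cmod z" for p
    by (rule dual_probability_interpolating [OF de \<tau> [OF that]])
  obtain N1 where N1: "prob_space N1" "sets N1 = sets dual_borel"
    "\<forall>\<gamma>\<in>?E. (LINT x|N1. x \<gamma>) = of_real (\<tau> Re \<gamma>)"
    "\<forall>A\<in>sets dual_borel. \<forall>\<epsilon>>0. \<exists>C\<subseteq>A. compact C \<and> measure N1 (A - C) < \<epsilon>"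
    using ex [OF abs_Re_le_cmod] by (elim exE conjE) (rule that)
  obtain N2 where N2: "prob_space N2" "sets N2 = sets dual_borel"
    "\<forall>\<gamma>\<in>?E. (LINT x|N2. x \<gamma>) = of_real (\<tau> Im \<gamma>)"
    "\<forall>A\<in>sets dual_borel. \<forall>\<epsilon>>0. \<exists>C\<subseteq>A. compact C \<and> measure N2 (A - C) < \<epsilon>"
    using ex [OF abs_Im_le_cmod] by (elim exE conjE) (rule that)
  have fin: "finite_measure N1" "finite_measure N2"
    using N1(1) N2(1) by (simp_all add: prob_space.finite_measure)
  define \<mu> where "\<mu> A = Complex (s * measure N1 A) (s * measure N2 A)" for A
  have "regular_dual_measure \<mu>"
    unfolding \<mu>_def by (rule regular_dual_measure_combination [OF fin(1) N1(2) fin(2) N2(2) N1(4) N2(4) s])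
  moreover have "fourier_transform \<mu> \<gamma> = \<phi> \<gamma>" if \<gamma>: "\<gamma> \<in> ?E" for \<gamma>
  proof -
    have "fourier_transform \<mu> \<gamma> = s *\<^sub>R (LINT x|N1. cnj (x \<gamma>)) + \<i> * (s *\<^sub>R (LINT x|N2. cnj (x \<gamma>)))"
      unfolding fourier_transform_def complex_measure_integral_def \<mu>_def complex.sel
      using s by (simp add: signed_integral_scaled_measure [OF fin(1) N1(2)] signed_integral_scaled_measure [OF fin(2) N2(2)]
        measurable_cnj_evaluation)
    \<comment> \<open>The interpolated values are real, so the conjugation in the Fourier transform
      leaves them unchanged.\<close>
    also have "\<dots> = of_real (Re (\<phi> \<gamma>)) + \<i> * of_real (Im (\<phi> \<gamma>))"
      using N1(3) N2(3) \<gamma> s by (simp add: \<tau>_def scaleR_conv_of_real)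
    finally show ?thesis by (simp only: complex_eq [symmetric])
  qed
  ultimately show "\<exists>\<mu>. regular_dual_measure \<mu> \<and> (\<forall>\<gamma>\<in>?E. fourier_transform \<mu> \<gamma> = \<phi> \<gamma>)" by blast
qed

theorem corollary1:
  assumes "infinite (UNIV :: 'a::ab_group_add set)"
  shows "\<exists>E :: 'a set. Sidon_set E \<and> \<not> I0_set E"
proof (rule two_dissociate_sequences [OF assms])
  fix c d r :: "nat \<Rightarrow> 'a"
  assume r: "\<And>i j. i < j \<Longrightarrow> \<exists>k. r k = c i - c j"
    and dis: "dissociate d" "dissociate (\<lambda>k. d k + r k)"
    and sep: "\<And>k n. d k + r k \<notin> riesz_span d n" "\<And>k n. d k \<notin> riesz_span (\<lambda>k. d k + r k) n"
  have "Sidon_set (range d \<union> range (\<lambda>k. d k + r k))"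
    by (rule Sidon_set_two_dissociate [OF dis sep])
  \<comment> \<open>Each \<open>d l\<close> lies in the span of its own sequence at stage
    \<open>Suc l\<close>, which no \<open>d k + r k\<close> meets.\<close>
  moreover have "d k + r k \<noteq> d l" for k l
    using sep(1) [of k "Suc l"] riesz_span_generator [of d l] by metis
  then have "\<not> I0_set (range d \<union> range (\<lambda>k. d k + r k))"
    using r by (intro not_I0_set [where c = c])
  ultimately show ?thesis by blast
qed

end
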